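(* Let $X$ be a computable metric space. Then the identity map $\mathrm{id}:\mathcal A_*(X)\to\mathcal A_-(X)'$ is a computable isomorphism, i.e., $\mathrm{id}$ as well as its inverse are computable. In other words, the representations $\psi_*$ and $\psi_-':=\psi_-\circ\lim$ of the set of closed subsets of $X$ are computably equivalent.
   Context: A represented space $(X,\delta_X)$ is a set $X$ with a surjective partial map $\delta_X:\subseteq\mathbb N^{\mathbb N}\to X$. A map between represented spaces is computable if it has a computable realizer, i.e., a computable partial function on $\mathbb N^{\mathbb N}$ transforming names of inputs into names of outputs. With $\langle p_0,p_1,\dots\rangle(\langle i,j\rangle):=p_i(j)$, the sequence space $X^{\mathbb N}$ is represented by $\delta_X^{\mathbb N}\langle p_0,p_1,\dots\rangle:=(\delta_X(p_i))_i$. $\lim:\subseteq\mathbb N^{\mathbb N}\to\mathbb N^{\mathbb N}$, $\langle p_0,p_1,\dots\rangle\mapsto\lim_np_n$ (product topology). A computable metric space $(X,d,\alpha)$ is a metric space $(X,d)$ with a dense sequence $\alpha:\mathbb N\to X$ such that $d\circ(\alpha\times\alpha):\mathbb N^2\to\mathbb R$ is computable. Its Cauchy representation is $\delta_X(p)=\lim_n\alpha(p(n))$, for those $p$ such that the limit exists and $d(\alpha p(n),\alpha p(k))<2^{-k}$ for all $k$ and $n\ge k$. $X\sqcup\{\infty\}$ is $X$ with an additional isolated point $\infty$ at distance $1$ from all other points. $\mathcal A_-(X)$ is the set of closed subsets of $X$ with representation $\psi_-(p):=X\setminus\bigcup_iB_{p(i)}$, where $B_{\langle n,k\rangle}:=B(\alpha(n),\overline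 k)$ is the open ball and $\overline k$ the $k$-th rational in a standard enumeration. $\mathcal A_-(X)'$ is the same set with the representation $\psi_-':=\psi_-\circ\lim$. $\mathcal A_*(X)$ is the set of closed subsets of $X$ with the cluster point representation $\psi_*$: $\psi_*(p)=A$ iff $\delta^{\mathbb N}_{X\sqcup\{\infty\}}(p)=(x_n)_n$ and the set of all cluster points of $(x_n)_n$ in $X\sqcup\{\infty\}$, intersected with $X$, equals $A$. *)

theory Defs
  imports "HOL-Analysis.Analysis" "HOL-Library.Nat_Bijection"
begin

section \<open>Computability on Baire space\<close>

text \<open>
  Programs for partial recursive functions relative to an oracle \<open>p :: nat \<Rightarrow> nat\<close>.  A program
  applied to an argument list of unsuitable length is undefined or ignores the surplus
  arguments, so no separate arity discipline is needed.
\<close>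

datatype prog =
    Zero
  | Succ
  | Proj nat
  | Oracle
  | Comp prog "prog list"
  | Prec prog prog
  | Mu prog

fun eval :: "(nat \<Rightarrow> nat) \<Rightarrow> prog \<Rightarrow> nat list \<Rightarrow> nat option" where
  "eval p Zero xs = Some 0"
| "eval p Succ xs = (case xs of [] \<Rightarrow> None | x # _ \<Rightarrow> Some (Suc x))"
| "eval p (Proj i) xs = (if i < length xs then Some (xs ! i) else None)"
| "eval p Oracle xs = (case xs of [] \<Rightarrow> None | x # _ \<Rightarrow> Some (p x))"
| "eval p (Comp f gs) xs =
     (if \<forall>g \<in> set gs. eval p g xs \<noteq> None
      then eval p f (map (\<lambda>g. the (eval p g xs)) gs) else None)"
| "eval p (Prec f g) xs =
     (case xs of
        [] \<Rightarrow> None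
      | n # ys \<Rightarrow> rec_nat (eval p f ys)
          (\<lambda>m r. case r of None \<Rightarrow> None | Some v \<Rightarrow> eval p g (m # v # ys)) n)"
| "eval p (Mu f) xs =
     (if \<exists>z. eval p f (z # xs) = Some 0 \<and> (\<forall>y<z. eval p f (y # xs) \<noteq> None)
      then Some (LEAST z. eval p f (z # xs) = Some 0) else None)"

text \<open>
  As usual for Type-2 computability, a program only has to be correct on the domain of the
  partial function.
\<close>

definition computable_baire :: "((nat \<Rightarrow> nat) \<rightharpoonup> (nat \<Rightarrow> nat)) \<Rightarrow> bool" where
  "computable_baire F \<longleftrightarrow>
     (\<exists>M. \<forall>p q. F p = Some q \<longrightarrow> (\<forall>n. eval p M [n] = Some (q n)))"


section \<open>Represented spaces\<close>

text \<open>
  A representation of a set \<open>X\<close> is a partial map \<open>\<delta>\<close> on Baire space with \<open>ran \<delta> = X\<close>; the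
  represented set is thus determined by \<open>\<delta>\<close>.
\<close>

type_synonym 'a representation = "(nat \<Rightarrow> nat) \<rightharpoonup> 'a"

definition realizes ::
  "((nat \<Rightarrow> nat) \<rightharpoonup> (nat \<Rightarrow> nat)) \<Rightarrow> 'a representation \<Rightarrow> 'b representation \<Rightarrow> ('a \<Rightarrow> 'b) \<Rightarrow> bool"
where
  "realizes F \<delta>X \<delta>Y f \<longleftrightarrow>
     (\<forall>p x. \<delta>X p = Some x \<longrightarrow> (\<exists>q. F p = Some q \<and> \<delta>Y q = Some (f x)))"

definition computable_map :: "'a representation \<Rightarrow> 'b representation \<Rightarrow> ('a \<Rightarrow> 'b) \<Rightarrow> bool" where
  "computable_map \<delta>X \<delta>Y f \<longleftrightarrow> (\<exists>F. computable_baire F \<and> realizes F \<delta>X \<delta>Y f)"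

definition computable_isomorphism ::
  "'a representation \<Rightarrow> 'b representation \<Rightarrow> ('a \<Rightarrow> 'b) \<Rightarrow> bool" where
  "computable_isomorphism \<delta>X \<delta>Y f \<longleftrightarrow>
     bij_betw f (ran \<delta>X) (ran \<delta>Y) \<and>
     computable_map \<delta>X \<delta>Y f \<and>
     computable_map \<delta>Y \<delta>X (inv_into (ran \<delta>X) f)"

definition computably_reducible :: "'a representation \<Rightarrow> 'a representation \<Rightarrow> bool" where
  "computably_reducible \<delta> \<delta>' \<longleftrightarrow>
     (\<exists>F. computable_baire F \<and> (\<forall>p \<in> dom \<delta>. \<exists>q. F p = Some q \<and> \<delta>' q = \<delta> p))"

definition computably_equivalent :: "'a representation \<Rightarrow> 'a representation \<Rightarrow> bool" where
  "computably_equivalent \<delta> \<delta>' \<longleftrightarrow> computably_reducible \<delta> \<delta>' \<and> computably_reducible \<delta>' \<delta>"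

definition component :: "(nat \<Rightarrow> nat) \<Rightarrow> nat \<Rightarrow> (nat \<Rightarrow> nat)" where
  "component p i = (\<lambda>j. p (prod_encode (i, j)))"

definition seq_rep :: "'a representation \<Rightarrow> (nat \<Rightarrow> 'a) representation" where
  "seq_rep \<delta> p =
     (if \<forall>i. component p i \<in> dom \<delta> then Some (\<lambda>i. the (\<delta> (component p i))) else None)"

text \<open>Convergence in \<open>nat \<Rightarrow> nat\<close> is with respect to the product of the discrete topologies.\<close>

definition baire_lim :: "(nat \<Rightarrow> nat) \<rightharpoonup> (nat \<Rightarrow> nat)" where
  "baire_lim p =
     (if \<exists>q. component p \<longlonglongrightarrow> q then Some (THE q. component p \<longlonglongrightarrow> q) else None)"

text \<open>
  The distance is a parameter, and not the one of the class \<^class>\<open>metric_space\<close>, because the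
  definition is also used for \<open>X \<squnion> {\<infinity>}\<close> below.
\<close>

definition cauchy_rep :: "('a \<Rightarrow> 'a \<Rightarrow> real) \<Rightarrow> (nat \<Rightarrow> 'a) \<Rightarrow> 'a representation" where
  "cauchy_rep d \<alpha> p =
     (if (\<exists>x. (\<lambda>n. d (\<alpha> (p n)) x) \<longlonglongrightarrow> 0) \<and>
         (\<forall>k. \<forall>n\<ge>k. d (\<alpha> (p n)) (\<alpha> (p k)) < 1 / 2 ^ k)
      then Some (THE x. (\<lambda>n. d (\<alpha> (p n)) x) \<longlonglongrightarrow> 0) else None)"

text \<open>
  The standard enumeration of all rationals: the triple \<open>\<langle>i, j, k\<rangle>\<close> denotes
  \<open>(i - j) / (k + 1)\<close>.
\<close>

definition rat_enum :: "nat \<Rightarrow> real" where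
  "rat_enum n =
     (case prod_decode n of (i, m) \<Rightarrow> case prod_decode m of (j, k) \<Rightarrow>
        (real i - real j) / (real k + 1))"

definition real_rep :: "real representation" where
  "real_rep = cauchy_rep dist rat_enum"

text \<open>
  The product of the representation \<open>p \<mapsto> p 0\<close> of the natural numbers with itself, where a pair
  of sequences is coded by interleaving.
\<close>

definition nat_pair_rep :: "(nat \<times> nat) representation" where
  "nat_pair_rep p = Some (p 0, p 1)"


section \<open>Computable metric spaces and their closed subsets\<close>

definition computable_metric_space :: "(nat \<Rightarrow> 'a::metric_space) \<Rightarrow> bool" where
  "computable_metric_space \<alpha> \<longleftrightarrow>
     closure (range \<alpha>) = UNIV \<and>
     computable_map nat_pair_rep real_rep (\<lambda>(i, j). dist (\<alpha> i) (\<alpha> j))"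

datatype 'a with_infty = Pt 'a | Infty

text \<open>
  If \<open>X\<close> has diameter greater than \<open>2\<close>, then \<open>dist_infty\<close> violates the triangle inequality.  This
  is harmless: it still induces the topology of the disjoint sum, and the names in the
  Cauchy representation never mix \<open>Infty\<close> with points of \<open>X\<close>, because they
  satisfy \<open>d (\<alpha> (p n)) (\<alpha> (p 0)) < 1\<close>.
\<close>

fun dist_infty :: "'a::metric_space with_infty \<Rightarrow> 'a with_infty \<Rightarrow> real" where
  "dist_infty (Pt x) (Pt y) = dist x y"
| "dist_infty (Pt x) Infty = 1"
| "dist_infty Infty (Pt y) = 1"
| "dist_infty Infty Infty = 0"

fun dense_infty :: "(nat \<Rightarrow> 'a) \<Rightarrow> nat \<Rightarrow> 'a with_infty" where
  "dense_infty \<alpha> 0 = Infty"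
| "dense_infty \<alpha> (Suc n) = Pt (\<alpha> n)"

definition cluster_points :: "('a \<Rightarrow> 'a \<Rightarrow> real) \<Rightarrow> (nat \<Rightarrow> 'a) \<Rightarrow> 'a set" where
  "cluster_points d x = {y. \<forall>\<epsilon>>0. infinite {n. d (x n) y < \<epsilon>}}"

definition basic_ball :: "(nat \<Rightarrow> 'a::metric_space) \<Rightarrow> nat \<Rightarrow> 'a set" where
  "basic_ball \<alpha> m = (case prod_decode m of (n, k) \<Rightarrow> ball (\<alpha> n) (rat_enum k))"

definition psi_minus :: "(nat \<Rightarrow> 'a::metric_space) \<Rightarrow> 'a set representation" where
  "psi_minus \<alpha> p = Some (UNIV - (\<Union>i. basic_ball \<alpha> (p i)))"

definition psi_minus_jump :: "(nat \<Rightarrow> 'a::metric_space) \<Rightarrow> 'a set representation" where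
  "psi_minus_jump \<alpha> = psi_minus \<alpha> \<circ>\<^sub>m baire_lim"

definition psi_star :: "(nat \<Rightarrow> 'a::metric_space) \<Rightarrow> 'a set representation" where
  "psi_star \<alpha> p =
     map_option (\<lambda>x. Pt -` cluster_points dist_infty x)
       (seq_rep (cauchy_rep dist_infty (dense_infty \<alpha>)) p)"


section \<open>The represented sets\<close>

lemma dense_ex:
  fixes \<alpha> :: "nat \<Rightarrow> 'a::metric_space"
  assumes "closure (range \<alpha>) = UNIV" "e > 0"
  shows "\<exists>n. dist (\<alpha> n) x < e"
  using assms closure_approachable[of x "range \<alpha>"] by auto

lemma rat_enum_surj:
  assumes "r \<in> \<rat>"
  shows "\<exists>k. rat_enum k = r"
proof -
  obtain a b :: int where ab: "b > 0" "r = of_int a / of_int b"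
    using assms by (metis Rats_cases')
  define i j k where "i = nat a" and "j = nat (- a)" and "k = nat (b - 1)"
  have "rat_enum (prod_encode (i, prod_encode (j, k))) = (real i - real j) / (real k + 1)"
    by (simp add: rat_enum_def)
  also have "real i - real j = of_int a" by (simp add: i_def j_def)
  also have "real k + 1 = of_int b" using ab(1) by (simp add: k_def)
  finally show ?thesis using ab by blast
qed

lemma ran_psi_minus:
  assumes "closure (range \<alpha>) = UNIV"
  shows "ran (psi_minus \<alpha>) = {A. closed A}"
proof (intro equalityI subsetI)
  fix A assume "A \<in> ran (psi_minus \<alpha>)"
  then show "A \<in> {A. closed A}"
    by (auto simp: ran_def psi_minus_def basic_ball_def split: prod.splits
        intro!: closed_Diff open_UN)
next
  fix A :: "'a set" assume "A \<in> {A. closed A}"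
  then have op: "open (- A)" by (simp add: open_Compl)
  obtain k0 where k0: "rat_enum k0 = 0" using rat_enum_surj[of 0] by auto
  define p where "p m = (if basic_ball \<alpha> m \<subseteq> - A then m else prod_encode (0, k0))" for m
  have "(\<Union>i. basic_ball \<alpha> (p i)) = - A"
  proof (intro equalityI subsetI)
    fix x assume "x \<in> (\<Union>i. basic_ball \<alpha> (p i))"
    then show "x \<in> - A" by (auto simp: p_def basic_ball_def k0 split: if_splits)
  next
    fix x assume "x \<in> - A"
    then obtain e where e: "e > 0" "ball x e \<subseteq> - A" using op open_contains_ball by blast
    obtain n where n: "dist (\<alpha> n) x < e / 4" using dense_ex[OF assms, of "e / 4" x] e by auto
    obtain r where r: "r \<in> \<rat>" "e / 4 < r" "r < e / 2"
      using Rats_dense_in_real[of "e / 4" "e / 2"] e by auto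
    obtain k where k: "rat_enum k = r" using rat_enum_surj r by blast
    have "dist x y < e" if "dist (\<alpha> n) y < r" for y
      using dist_triangle[of x y "\<alpha> n"] that n r e by (simp add: dist_commute)
    then have "ball (\<alpha> n) r \<subseteq> - A" using e by (auto simp: subset_eq)
    then have "p (prod_encode (n, k)) = prod_encode (n, k)" by (simp add: p_def basic_ball_def k)
    moreover have "x \<in> basic_ball \<alpha> (prod_encode (n, k))"
      using n r by (simp add: basic_ball_def k)
    ultimately show "x \<in> (\<Union>i. basic_ball \<alpha> (p i))" by (metis UN_I UNIV_I)
  qed
  then have "psi_minus \<alpha> p = Some A" by (simp add: psi_minus_def Compl_eq_Diff_UNIV[symmetric])
  then show "A \<in> ran (psi_minus \<alpha>)" by (auto simp: ran_def)
qed

lemma baire_tendsto_imp_eventually: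
  fixes s :: "nat \<Rightarrow> nat \<Rightarrow> nat"
  assumes "s \<longlonglongrightarrow> q"
  shows "\<forall>\<^sub>F n in sequentially. s n j = q j"
proof -
  have "continuous_on UNIV (\<lambda>f :: nat \<Rightarrow> nat. f j)" by (rule continuous_on_product_coordinates)
  then have "open ((\<lambda>f :: nat \<Rightarrow> nat. f j) -` {q j})"
    by (rule open_vimage[rotated]) (rule open_discrete)
  then have "\<forall>\<^sub>F n in sequentially. s n \<in> (\<lambda>f. f j) -` {q j}"
    using assms by (intro topological_tendstoD) auto
  then show ?thesis by simp
qed

lemma baire_tendsto_unique:
  fixes s :: "nat \<Rightarrow> nat \<Rightarrow> nat"
  assumes "s \<longlonglongrightarrow> q" "s \<longlonglongrightarrow> q'"
  shows "q = q'"
proof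
  fix j
  have "\<forall>\<^sub>F n in sequentially. s n j = q j \<and> s n j = q' j"
    using assms by (intro eventually_conj baire_tendsto_imp_eventually)
  then show "q j = q' j" using eventually_happens[of _ sequentially] by fastforce
qed

lemma baire_lim_eq_Some_iff: "baire_lim p = Some q \<longleftrightarrow> component p \<longlonglongrightarrow> q"
proof -
  have "(THE q. component p \<longlonglongrightarrow> q) = r" if "component p \<longlonglongrightarrow> r" for r
    using that baire_tendsto_unique by (intro the_equality) auto
  then show ?thesis by (auto simp: baire_lim_def)
qed

lemma ran_baire_lim: "ran baire_lim = UNIV"
proof -
  have "baire_lim (\<lambda>m. q (snd (prod_decode m))) = Some q" for q
  proof -
    have "component (\<lambda>m. q (snd (prod_decode m))) = (\<lambda>_. q)" by (simp add: component_def fun_eq_iff)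
    then show ?thesis by (simp add: baire_lim_eq_Some_iff)
  qed
  then show ?thesis by (auto simp: ran_def)
qed

lemma ran_psi_minus_jump:
  assumes "closure (range \<alpha>) = UNIV"
  shows "ran (psi_minus_jump \<alpha>) = {A. closed A}"
proof -
  have "ran (psi_minus_jump \<alpha>) = ran (psi_minus \<alpha>)"
  proof -
    have "\<exists>p. baire_lim p = Some q" for q
      using ran_baire_lim by (auto simp: ran_def)
    then show ?thesis
      unfolding psi_minus_jump_def ran_def map_comp_def
      by (auto split: option.splits) (metis option.sel)
  qed
  then show ?thesis using ran_psi_minus[OF assms] by simp
qed

lemma cauchy_rep_infty_surj:
  assumes dense: "closure (range \<alpha>) = UNIV"
  shows "\<exists>p. cauchy_rep dist_infty (dense_infty \<alpha>) p = Some x"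
proof (cases x)
  case Infty
  have "(THE y. (\<lambda>n::nat. dist_infty (Infty :: 'a with_infty) y) \<longlonglongrightarrow> 0) = Infty"
  proof (rule the_equality)
    fix y :: "'a with_infty" assume "(\<lambda>n::nat. dist_infty Infty y) \<longlonglongrightarrow> 0"
    then show "y = Infty" by (cases y) (simp_all add: LIMSEQ_const_iff)
  qed simp
  moreover have "\<exists>y. (\<lambda>n::nat. dist_infty (Infty :: 'a with_infty) y) \<longlonglongrightarrow> 0"
    by (rule exI[of _ Infty]) simp
  ultimately have "cauchy_rep dist_infty (dense_infty \<alpha>) (\<lambda>_. 0) = Some Infty"
    by (simp add: cauchy_rep_def)
  then show ?thesis using Infty by blast
next
  case (Pt a)
  have "\<forall>k. \<exists>n. dist (\<alpha> n) a < 1 / 2 ^ (k + 2)" using dense_ex[OF dense] by simp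
  then obtain f where f: "\<And>k. dist (\<alpha> (f k)) a < 1 / 2 ^ (k + 2)" by metis
  have "(\<lambda>k::nat. 1 / 2 ^ (k + 2) :: real) \<longlonglongrightarrow> 0"
    using LIMSEQ_ignore_initial_segment[OF LIMSEQ_inverse_realpow_zero[of 2], of 2]
    by (simp add: inverse_eq_divide)
  then have "(\<lambda>k. dist (\<alpha> (f k)) a) \<longlonglongrightarrow> 0"
    by (rule Lim_null_comparison[rotated])
      (intro always_eventually allI, use f in \<open>simp add: less_imp_le\<close>)
  then have lim: "(\<lambda>k. \<alpha> (f k)) \<longlonglongrightarrow> a" using tendsto_dist_iff by blast
  have "(THE y. (\<lambda>n. dist_infty (Pt (\<alpha> (f n))) y) \<longlonglongrightarrow> 0) = Pt a"
  proof (rule the_equality)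
    show "(\<lambda>n. dist_infty (Pt (\<alpha> (f n))) (Pt a)) \<longlonglongrightarrow> 0"
      using lim by (simp add: tendsto_dist_iff[symmetric])
    fix y assume y: "(\<lambda>n. dist_infty (Pt (\<alpha> (f n))) y) \<longlonglongrightarrow> 0"
    show "y = Pt a"
    proof (cases y)
      case (Pt b)
      then have "(\<lambda>k. \<alpha> (f k)) \<longlonglongrightarrow> b" using y by (simp add: tendsto_dist_iff[symmetric])
      then show ?thesis using LIMSEQ_unique lim Pt by blast
    qed (use y in \<open>simp add: LIMSEQ_const_iff\<close>)
  qed
  moreover have "\<exists>y. (\<lambda>n. dist_infty (Pt (\<alpha> (f n))) y) \<longlonglongrightarrow> 0"
    by (rule exI[of _ "Pt a"]) (use lim in \<open>simp add: tendsto_dist_iff[symmetric]\<close>)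
  moreover have "dist (\<alpha> (f n)) (\<alpha> (f k)) < 1 / 2 ^ k" if "k \<le> n" for n k
  proof -
    have "1 / 2 ^ (n + 2) \<le> (1 / 2 ^ (k + 2) :: real)" using that by (simp add: field_simps)
    moreover have "(1 / 2 ^ k :: real) = 4 * (1 / 2 ^ (k + 2))" by simp
    moreover have "(0 :: real) < 1 / 2 ^ (k + 2)" by simp
    ultimately show ?thesis
      using f[of n] f[of k] dist_triangle2[of "\<alpha> (f n)" "\<alpha> (f k)" a] by linarith
  qed
  ultimately have "cauchy_rep dist_infty (dense_infty \<alpha>) (\<lambda>k. Suc (f k)) = Some (Pt a)"
    by (simp add: cauchy_rep_def)
  then show ?thesis using Pt by blast
qed

lemma seq_rep_surj:
  assumes "\<And>x. \<exists>p. \<delta> p = Some x"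
  shows "\<exists>p. seq_rep \<delta> p = Some xs"
proof -
  obtain P where P: "\<And>i. \<delta> (P i) = Some (xs i)" using choice[of "\<lambda>i p. \<delta> p = Some (xs i)"] assms by auto
  define p where "p = (\<lambda>m. case prod_decode m of (i, j) \<Rightarrow> P i j)"
  have "component p i = P i" for i by (simp add: component_def p_def)
  then have "seq_rep \<delta> p = Some xs" using P by (simp add: seq_rep_def dom_def)
  then show ?thesis by blast
qed

lemma closed_cluster_points: "closed (Pt -` cluster_points dist_infty x)"
proof (subst closed_sequential_limits, intro allI impI, elim conjE)
  fix s l assume s: "\<forall>n. s n \<in> Pt -` cluster_points dist_infty x" and l: "s \<longlonglongrightarrow> l"
  show "l \<in> Pt -` cluster_points dist_infty x"
    unfolding cluster_points_def vimage_Collect_eq mem_Collect_eq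
  proof (intro allI impI)
    fix e :: real assume e: "0 < e"
    define e' where "e' = min e 1"
    have e': "0 < e'" "e' \<le> e" "e' \<le> 1" using e by (auto simp: e'_def)
    obtain n where n: "dist (s n) l < e' / 2" using l e' by (meson half_gt_zero lim_sequentially order_refl)
    have "infinite {m. dist_infty (x m) (Pt (s n)) < e' / 2}"
      using s half_gt_zero[OF e'(1)] unfolding cluster_points_def by blast
    moreover have "{m. dist_infty (x m) (Pt (s n)) < e' / 2} \<subseteq> {m. dist_infty (x m) (Pt l) < e}"
    proof (intro subsetI CollectI, drule CollectD)
      fix m assume m: "dist_infty (x m) (Pt (s n)) < e' / 2"
      show "dist_infty (x m) (Pt l) < e"
      proof (cases "x m")
        case (Pt a)
        then show ?thesis using m n e' dist_triangle[of a l "s n"] by simp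
      qed (use m e' in simp)
    qed
    ultimately show "infinite {m. dist_infty (x m) (Pt l) < e}" using infinite_super by blast
  qed
qed

lemma ran_psi_star:
  assumes dense: "closure (range \<alpha>) = UNIV"
  shows "ran (psi_star \<alpha>) = {A. closed A}"
proof (intro equalityI subsetI)
  fix A assume "A \<in> ran (psi_star \<alpha>)"
  then show "A \<in> {A. closed A}"
    using closed_cluster_points by (auto simp: ran_def psi_star_def)
next
  fix A :: "'a set" assume "A \<in> {A. closed A}"
  then have A: "closed A" by simp
  define B where "B m = (case prod_decode m of (n, k) \<Rightarrow> A \<inter> ball (\<alpha> n) (1 / Suc k))" for m
  define y where "y m = (if B m = {} then Infty else Pt (SOME a. a \<in> B m))" for m
  define x where "x m = y (snd (prod_decode m))" for m
  have B: "\<exists>a \<in> B m. y m = Pt a" if "B m \<noteq> {}" for m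
    using that by (auto simp: y_def some_in_eq)
  have "Pt -` cluster_points dist_infty x = A"
  proof (intro equalityI subsetI)
    fix a assume "a \<in> Pt -` cluster_points dist_infty x"
    then have inf: "infinite {n. dist_infty (x n) (Pt a) < e}" if "e > 0" for e
      using that by (simp add: cluster_points_def)
    have "\<exists>b \<in> A. dist b a < e" if e: "e > 0" for e
    proof -
      obtain n where n: "dist_infty (x n) (Pt a) < min e 1"
        using not_finite_existsD[OF inf[of "min e 1"]] e by auto
      then obtain b where b: "x n = Pt b" by (cases "x n") auto
      then have "b \<in> A"
        using B[of "snd (prod_decode n)"]
        by (auto simp: x_def y_def B_def split: if_splits prod.splits)
      then show ?thesis using n b by auto
    qed
    then show "a \<in> A" using A closed_approachable by blast
  next
    fix a assume a: "a \<in> A"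
    have "infinite {n. dist_infty (x n) (Pt a) < e}" if e: "e > 0" for e
    proof -
      obtain k where k: "1 / Suc k < e / 2"
        using nat_approx_posE[OF half_gt_zero[OF e]] by blast
      obtain n where n: "dist (\<alpha> n) a < 1 / Suc k" using dense_ex[OF dense, of "1 / Suc k"] by auto
      define m where "m = prod_encode (n, k)"
      have "a \<in> B m" using a n by (simp add: B_def m_def)
      then obtain b where b: "b \<in> B m" "y m = Pt b" using B by blast
      have "dist b a < e"
        using b(1) n k dist_triangle[of b a "\<alpha> n"] by (simp add: B_def m_def dist_commute)
      then have "range (\<lambda>i. prod_encode (i, m)) \<subseteq> {n. dist_infty (x n) (Pt a) < e}"
        using b by (auto simp: x_def)
      moreover have "infinite (range (\<lambda>i. prod_encode (i, m)))"
        by (rule range_inj_infinite) (simp add: inj_def)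
      ultimately show ?thesis using infinite_super by blast
    qed
    then show "a \<in> Pt -` cluster_points dist_infty x" by (simp add: cluster_points_def)
  qed
  moreover obtain p where "seq_rep (cauchy_rep dist_infty (dense_infty \<alpha>)) p = Some x"
    using seq_rep_surj cauchy_rep_infty_surj[OF dense] by metis
  ultimately have "psi_star \<alpha> p = Some A" by (simp add: psi_star_def)
  then show "A \<in> ran (psi_star \<alpha>)" by (auto simp: ran_def)
qed

end

theory Submission
  imports Defs
begin

text \<open>
  Both directions rest on one decidable relation \<open>I n m k\<close>, a formal inclusion: it certifies that
  the closed ball of radius \<open>1/2\<^sup>k\<close> around \<open>\<alpha> n\<close> lies in the basic ball with code \<open>m\<close>, and it
  holds as soon as this inclusion has some room to spare.  It is decided by computing the distance
  of two centres up to \<open>1/2\<^sup>k\<close> and comparing rationals.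

  From cluster points to the complement (\<open>psi_minus_jump_avoided_balls\<close>): a point lies outside the
  set of cluster points of \<open>x\<close> iff some basic ball around it contains no \<open>x i\<close> with \<open>i \<ge> N\<close>, for
  some \<open>N\<close>.  That \<open>x i\<close> lies in a basic ball is semidecidable through \<open>I\<close>, so the ball with code
  \<open>m\<close> is enumerated, once for each \<open>N\<close>, as long as no such \<open>x i\<close> has been found, and replaced
  by the empty ball afterwards.  Each entry changes at most once, so the limit exists.

  From the complement to cluster points (\<open>psi_star_net_sequence_name\<close>): let \<open>A\<close> be the complement of
  the balls \<open>q i\<close>, where \<open>q\<close> is the limit of \<open>q\<^sub>0, q\<^sub>1, \<dots>\<close>.  At precision \<open>k\<close>, a dense point is
  consistent if it is not formally inside one of the balls \<open>q 0, \<dots>, q k\<close>; points within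
  \<open>1/2\<^sup>k\<close> of \<open>A\<close> are consistent, and close to a point outside \<open>A\<close> only finitely many precisions have
  consistent points.  At a single precision, however, infinitely many consistent points may
  accumulate outside \<open>A\<close>.  Hence the consistent points are thinned out greedily to a net that
  is separated by \<open>1/2\<^sup>k\<close>: such a net has no cluster points, but its elements still come
  within \<open>4/2\<^sup>k\<close> of every point of \<open>A\<close>.  The net is computed from the current approximation
  \<open>q\<^sub>s\<close>, and an element is put into the sequence anew only when \<open>q\<^sub>s\<close> changes on \<open>{0..k}\<close>, which
  happens finitely often.  All other entries of the sequence are the isolated point \<open>\<infinity>\<close>.

  Both constructions are defined for arbitrary arguments.  Their computability therefore
  reduces to closure properties of a class of total functions of an oracle and finitely many
  numbers.
\<close>

section \<open>Total functions computable from an oracle and finitely many numbers\<close>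

text \<open>
  The argument \<open>e\<close> of \<open>f\<close> is an environment of arbitrary type; the program sees only the oracle
  \<open>orc e\<close> and the numbers \<open>v e\<close> for the variables \<open>v\<close> in \<open>vs\<close>.  With this form, functions are
  written as ordinary lambda terms, and a bound variable is added by pairing it with the
  environment.
\<close>

definition computable_in :: "('e \<Rightarrow> nat \<Rightarrow> nat) \<Rightarrow> ('e \<Rightarrow> nat) list \<Rightarrow> ('e \<Rightarrow> nat) \<Rightarrow> bool" where
  "computable_in orc vs f \<longleftrightarrow> (\<exists>M. \<forall>e. eval (orc e) M (map (\<lambda>v. v e) vs) = Some (f e))"

definition decidable_in :: "('e \<Rightarrow> nat \<Rightarrow> nat) \<Rightarrow> ('e \<Rightarrow> nat) list \<Rightarrow> ('e \<Rightarrow> bool) \<Rightarrow> bool" where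
  "decidable_in orc vs P \<longleftrightarrow> computable_in orc vs (\<lambda>e. of_bool (P e))"

lemma computable_in_var:
  assumes "v \<in> set vs"
  shows "computable_in orc vs v"
proof -
  obtain i where "i < length vs" "vs ! i = v" using assms by (auto simp: in_set_conv_nth)
  then have "\<forall>e. eval (orc e) (Proj i) (map (\<lambda>v. v e) vs) = Some (v e)" by auto
  then show ?thesis unfolding computable_in_def by blast
qed

text \<open>
  Composition.  It also accounts for passing to another environment, which is why the
  environment transformation \<open>h\<close> appears.
\<close>

lemma computable_in_subst:
  assumes f: "computable_in orc vs f"
    and vs: "\<And>v. v \<in> set vs \<Longrightarrow> computable_in (\<lambda>e. orc (h e)) ws (\<lambda>e. v (h e))"
  shows "computable_in (\<lambda>e. orc (h e)) ws (\<lambda>e. f (h e))"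
proof -
  obtain M where M: "\<And>e. eval (orc e) M (map (\<lambda>v. v e) vs) = Some (f e)"
    using f unfolding computable_in_def by blast
  have "\<forall>v\<in>set vs. \<exists>G. \<forall>e. eval (orc (h e)) G (map (\<lambda>w. w e) ws) = Some (v (h e))"
    using vs unfolding computable_in_def by blast
  then obtain G where G: "\<And>v e. v \<in> set vs \<Longrightarrow>
      eval (orc (h e)) (G v) (map (\<lambda>w. w e) ws) = Some (v (h e))"
    by metis
  have "eval (orc (h e)) (Comp M (map G vs)) (map (\<lambda>w. w e) ws) = Some (f (h e))" for e
  proof -
    have "map (\<lambda>g. the (eval (orc (h e)) g (map (\<lambda>w. w e) ws))) (map G vs) = map (\<lambda>v. v (h e)) vs"
      using G by simp
    then show ?thesis using G M[of "h e"] by (simp add: map_map[symmetric] del: map_map)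
  qed
  then show ?thesis unfolding computable_in_def by blast
qed

lemma computable_in_Suc:
  assumes "computable_in orc vs f"
  shows "computable_in orc vs (\<lambda>e. Suc (f e))"
proof -
  have "computable_in orc [f] (\<lambda>e. Suc (f e))"
    unfolding computable_in_def by (rule exI[of _ Succ]) simp
  from computable_in_subst[OF this, where h = "\<lambda>e. e"] show ?thesis using assms by simp
qed

lemma computable_in_oracle:
  assumes "computable_in orc vs f"
  shows "computable_in orc vs (\<lambda>e. orc e (f e))"
proof -
  have "computable_in orc [f] (\<lambda>e. orc e (f e))"
    unfolding computable_in_def by (rule exI[of _ Oracle]) simp
  from computable_in_subst[OF this, where h = "\<lambda>e. e"] show ?thesis using assms by simp
qed

lemma computable_in_const: "computable_in orc vs (\<lambda>e. c)"
proof (induction c)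
  case 0
  show ?case unfolding computable_in_def by (rule exI[of _ Zero]) simp
next
  case (Suc c)
  then show ?case by (rule computable_in_Suc)
qed

lemma computable_in_rec:
  assumes n: "computable_in orc vs n"
    and f: "computable_in orc vs f"
    and g: "computable_in (\<lambda>z. orc (snd (snd z)))
              (fst # (\<lambda>z. fst (snd z)) # map (\<lambda>v z. v (snd (snd z))) vs)
              (\<lambda>z. g (fst z) (fst (snd z)) (snd (snd z)))"
  shows "computable_in orc vs (\<lambda>e. rec_nat (f e) (\<lambda>m r. g m r e) (n e))"
proof -
  obtain F where F: "\<And>e. eval (orc e) F (map (\<lambda>v. v e) vs) = Some (f e)"
    using f unfolding computable_in_def by blast
  obtain G where G: "\<And>z. eval (orc (snd (snd z))) G (map (\<lambda>v. v z) 
      (fst # (\<lambda>z. fst (snd z)) # map (\<lambda>v z. v (snd (snd z))) vs)) =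
      Some (g (fst z) (fst (snd z)) (snd (snd z)))"
    using g unfolding computable_in_def by blast
  have G': "eval (orc e) G (m # r # map (\<lambda>v. v e) vs) = Some (g m r e)" for m r e
    using G[of "(m, r, e)"] by (simp add: comp_def)
  have rec: "rec_nat (Some (f e)) (\<lambda>m r. case r of None \<Rightarrow> None
          | Some v \<Rightarrow> eval (orc e) G (m # v # map (\<lambda>v. v e) vs)) k
        = Some (rec_nat (f e) (\<lambda>m r. g m r e) k)" for e k
    by (induction k) (simp_all add: G')
  have "computable_in orc (n # vs) (\<lambda>e. rec_nat (f e) (\<lambda>m r. g m r e) (n e))"
    unfolding computable_in_def by (rule exI[of _ "Prec F G"]) (simp add: F rec)
  from computable_in_subst[OF this, where h = "\<lambda>e. e"] show ?thesis
    using n computable_in_var[of _ vs orc] by auto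
qed

lemma computable_in_lift:
  assumes "computable_in orc vs f"
  shows "computable_in (\<lambda>z. orc (snd z)) (fst # map (\<lambda>v z. v (snd z)) vs) (\<lambda>z. f (snd z))"
  by (rule computable_in_subst[OF assms, where h = snd]) (auto intro: computable_in_var)

lemma computable_in_lift_rec:
  assumes "computable_in orc vs f"
  shows "computable_in (\<lambda>z. orc (snd (snd z)))
           (fst # (\<lambda>z. fst (snd z)) # map (\<lambda>v z. v (snd (snd z))) vs) (\<lambda>z. f (snd (snd z)))"
  by (rule computable_in_subst[OF assms, where h = "\<lambda>z. snd (snd z)"])
    (auto intro: computable_in_var)

lemma computable_in_rec_vars:
  "computable_in orc (fst # vs) fst"
  "computable_in orc' (fst # (\<lambda>z. fst (snd z)) # vs') (\<lambda>z. fst (snd z))"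
  by (simp_all add: computable_in_var)

section \<open>Arithmetic, bounded quantification and unbounded search\<close>

lemma computable_in_add:
  assumes "computable_in orc vs f" "computable_in orc vs g"
  shows "computable_in orc vs (\<lambda>e. f e + g e)"
proof -
  have "rec_nat a (\<lambda>m r. Suc r) n = a + n" for a n by (induction n) auto
  moreover have "computable_in orc vs (\<lambda>e. rec_nat (f e) (\<lambda>m r. Suc r) (g e))"
    by (intro computable_in_rec assms computable_in_Suc computable_in_rec_vars)
  ultimately show ?thesis by simp
qed

lemma computable_in_mult:
  assumes "computable_in orc vs f" "computable_in orc vs g"
  shows "computable_in orc vs (\<lambda>e. f e * g e)"
proof -
  have "rec_nat 0 (\<lambda>m r. r + a) n = a * n" for a n :: nat by (induction n) auto
  moreover have "computable_in orc vs (\<lambda>e. rec_nat 0 (\<lambda>m r. r + f e) (g e))"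
    by (intro computable_in_rec computable_in_const assms computable_in_add computable_in_rec_vars
        computable_in_lift_rec)
  ultimately show ?thesis by simp
qed

lemma computable_in_power:
  assumes "computable_in orc vs f" "computable_in orc vs g"
  shows "computable_in orc vs (\<lambda>e. f e ^ g e)"
proof -
  have "rec_nat 1 (\<lambda>m r. r * a) n = a ^ n" for a n :: nat by (induction n) auto
  moreover have "computable_in orc vs (\<lambda>e. rec_nat 1 (\<lambda>m r. r * f e) (g e))"
    by (intro computable_in_rec computable_in_const assms computable_in_mult computable_in_rec_vars
        computable_in_lift_rec)
  ultimately show ?thesis by simp
qed

lemma computable_in_pred:
  assumes "computable_in orc vs f"
  shows "computable_in orc vs (\<lambda>e. f e - 1)"
proof -
  have "rec_nat 0 (\<lambda>m r. m) n = n - 1" for n :: nat by (induction n) auto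
  moreover have "computable_in orc vs (\<lambda>e. rec_nat 0 (\<lambda>m r. m) (f e))"
    by (intro computable_in_rec computable_in_const assms computable_in_rec_vars)
  ultimately show ?thesis by simp
qed

lemma computable_in_diff:
  assumes "computable_in orc vs f" "computable_in orc vs g"
  shows "computable_in orc vs (\<lambda>e. f e - g e)"
proof -
  have "rec_nat a (\<lambda>m r. r - 1) n = a - n" for a n :: nat by (induction n) auto
  moreover have "computable_in orc vs (\<lambda>e. rec_nat (f e) (\<lambda>m r. r - 1) (g e))"
    by (intro computable_in_rec computable_in_pred assms computable_in_rec_vars)
  ultimately show ?thesis by simp
qed

lemma decidable_in_less:
  assumes "computable_in orc vs f" "computable_in orc vs g"
  shows "decidable_in orc vs (\<lambda>e. f e < g e)"
proof -
  have "computable_in orc vs (\<lambda>e. 1 - (1 - (g e - f e)))"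
    by (intro computable_in_diff computable_in_const assms)
  moreover have "1 - (1 - (b - a)) = of_bool (a < b)" for a b :: nat by auto
  ultimately show ?thesis by (simp add: decidable_in_def)
qed

lemma decidable_in_not:
  assumes "decidable_in orc vs P"
  shows "decidable_in orc vs (\<lambda>e. \<not> P e)"
proof -
  have "computable_in orc vs (\<lambda>e. 1 - of_bool (P e))"
    using assms unfolding decidable_in_def by (intro computable_in_diff computable_in_const)
  moreover have "1 - of_bool b = (of_bool (\<not> b) :: nat)" for b by simp
  ultimately show ?thesis by (simp only: decidable_in_def)
qed

lemma decidable_in_conj:
  assumes "decidable_in orc vs P" "decidable_in orc vs Q"
  shows "decidable_in orc vs (\<lambda>e. P e \<and> Q e)"
  using computable_in_mult[OF assms[unfolded decidable_in_def]]
  by (simp add: decidable_in_def of_bool_conj)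

lemma decidable_in_disj:
  assumes "decidable_in orc vs P" "decidable_in orc vs Q"
  shows "decidable_in orc vs (\<lambda>e. P e \<or> Q e)"
  using decidable_in_not[OF decidable_in_conj[OF assms[THEN decidable_in_not]]] by simp

lemma decidable_in_imp:
  assumes "decidable_in orc vs P" "decidable_in orc vs Q"
  shows "decidable_in orc vs (\<lambda>e. P e \<longrightarrow> Q e)"
  using decidable_in_disj[OF decidable_in_not[OF assms(1)] assms(2)] by simp

lemma decidable_in_le:
  assumes "computable_in orc vs f" "computable_in orc vs g"
  shows "decidable_in orc vs (\<lambda>e. f e \<le> g e)"
  using decidable_in_not[OF decidable_in_less[OF assms(2,1)]] by (simp add: not_less)

lemma decidable_in_eq:
  assumes "computable_in orc vs f" "computable_in orc vs g"
  shows "decidable_in orc vs (\<lambda>e. f e = g e)"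
  using decidable_in_conj[OF decidable_in_le[OF assms] decidable_in_le[OF assms(2,1)]]
  by (simp only: order_eq_iff[symmetric])

lemma computable_in_if:
  assumes "decidable_in orc vs P" "computable_in orc vs f" "computable_in orc vs g"
  shows "computable_in orc vs (\<lambda>e. if P e then f e else g e)"
proof -
  have "computable_in orc vs (\<lambda>e. of_bool (P e) * f e + (1 - of_bool (P e)) * g e)"
    using assms unfolding decidable_in_def
    by (intro computable_in_add computable_in_mult computable_in_diff computable_in_const)
  moreover have "of_bool (P e) * f e + (1 - of_bool (P e)) * g e = (if P e then f e else g e)" for e
    by simp
  ultimately show ?thesis by simp
qed

lemma decidable_in_all_less:
  assumes b: "computable_in orc vs b"
    and P: "decidable_in (\<lambda>z. orc (snd z)) (fst # map (\<lambda>v z. v (snd z)) vs)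
      (\<lambda>z. P (fst z) (snd z))"
  shows "decidable_in orc vs (\<lambda>e. \<forall>i<b e. P i e)"
proof -
  have "computable_in (\<lambda>z. orc (snd (fst z, snd (snd z))))
      (fst # (\<lambda>z. fst (snd z)) # map (\<lambda>v z. v (snd (snd z))) vs)
      (\<lambda>z. of_bool (P (fst (fst z, snd (snd z))) (snd (fst z, snd (snd z)))))"
    by (rule computable_in_subst[OF P[unfolded decidable_in_def], where h = "\<lambda>z. (fst z, snd (snd z))"])
      (auto intro: computable_in_var)
  then have "computable_in (\<lambda>z. orc (snd (snd z)))
      (fst # (\<lambda>z. fst (snd z)) # map (\<lambda>v z. v (snd (snd z))) vs)
      (\<lambda>z. of_bool (P (fst z) (snd (snd z))))" by simp
  then have "computable_in orc vs (\<lambda>e. rec_nat 1 (\<lambda>m r. r * of_bool (P m e)) (b e))"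
    by (intro computable_in_rec b computable_in_const computable_in_mult computable_in_rec_vars)
  moreover have "rec_nat 1 (\<lambda>m r. r * of_bool (P m e)) n = (of_bool (\<forall>i<n. P i e) :: nat)" for e n
    by (induction n) (auto simp: less_Suc_eq)
  ultimately show ?thesis by (simp add: decidable_in_def)
qed

lemma decidable_in_all_le:
  assumes "computable_in orc vs b"
    and "decidable_in (\<lambda>z. orc (snd z)) (fst # map (\<lambda>v z. v (snd z)) vs)
      (\<lambda>z. P (fst z) (snd z))"
  shows "decidable_in orc vs (\<lambda>e. \<forall>i\<le>b e. P i e)"
  using decidable_in_all_less[OF computable_in_Suc[OF assms(1)] assms(2)]
  by (simp add: less_Suc_eq_le)

lemma decidable_in_ex_le:
  assumes "computable_in orc vs b"
    and "decidable_in (\<lambda>z. orc (snd z)) (fst # map (\<lambda>v z. v (snd z)) vs)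
      (\<lambda>z. P (fst z) (snd z))"
  shows "decidable_in orc vs (\<lambda>e. \<exists>i\<le>b e. P i e)"
  using decidable_in_not[OF decidable_in_all_le[OF assms(1) decidable_in_not[OF assms(2)]]]
  by simp

lemma computable_in_Least:
  assumes P: "decidable_in (\<lambda>z. orc (snd z)) (fst # map (\<lambda>v z. v (snd z)) vs)
      (\<lambda>z. P (fst z) (snd z))"
    and ex: "\<And>e. \<exists>i. P i e"
  shows "computable_in orc vs (\<lambda>e. LEAST i. P i e)"
proof -
  obtain M where "\<And>z. eval (orc (snd z)) M (map (\<lambda>v. v z) (fst # map (\<lambda>v z. v (snd z)) vs)) =
      Some (of_bool (\<not> P (fst z) (snd z)))"
    using decidable_in_not[OF P] unfolding decidable_in_def computable_in_def by blast
  from this[of "(i, e)" for i e]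
  have M: "eval (orc e) M (i # map (\<lambda>v. v e) vs) = Some (of_bool (\<not> P i e))" for i e
    by (simp add: comp_def)
  have "eval (orc e) (Mu M) (map (\<lambda>v. v e) vs) = Some (LEAST i. P i e)" for e
    using ex[of e] by (simp add: M)
  then show ?thesis unfolding computable_in_def by blast
qed

lemmas computable_intros =
  decidable_in_all_less decidable_in_all_le decidable_in_ex_le
  decidable_in_less decidable_in_le decidable_in_eq
  decidable_in_not decidable_in_conj decidable_in_disj decidable_in_imp
  computable_in_if computable_in_add computable_in_mult computable_in_power computable_in_diff
  computable_in_Suc computable_in_const

section \<open>Codes of pairs and of finite sets\<close>

lemma computable_in_div:
  assumes "computable_in orc vs f" "computable_in orc vs g" "\<And>e. g e > 0"
  shows "computable_in orc vs (\<lambda>e. f e div g e)"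
proof -
  have ex: "\<exists>h. a < b * Suc h" if "b > 0" for a b :: nat
    using that dividend_less_times_div[of b a] by (intro exI[of _ "a div b"]) simp
  have "computable_in orc vs (\<lambda>e. LEAST h. f e < g e * Suc h)"
    by (intro computable_in_Least computable_intros computable_in_lift assms computable_in_rec_vars
        ex)
  moreover have "(LEAST h. a < b * Suc h) = a div b" if "b > 0" for a b :: nat
    using that by (intro Least_equality)
      (auto simp: dividend_less_times_div less_Suc_eq_le[symmetric] less_mult_imp_div_less
        mult.commute)
  ultimately show ?thesis using assms(3) by simp
qed

lemma decidable_in_set_decode:
  assumes "computable_in orc vs f" "computable_in orc vs g"
  shows "decidable_in orc vs (\<lambda>e. f e \<in> set_decode (g e))"
proof -
  have "odd n \<longleftrightarrow> (\<exists>h\<le>n. n = 2 * h + 1)" for n :: nat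
    by (auto elim!: oddE)
  moreover have "decidable_in orc vs
      (\<lambda>e. \<exists>h\<le>g e div 2 ^ f e. g e div 2 ^ f e = 2 * h + 1)"
    by (intro computable_intros computable_in_lift computable_in_div assms computable_in_rec_vars)
      auto
  ultimately show ?thesis by (simp add: set_decode_def)
qed

lemma computable_in_prod_encode:
  assumes "computable_in orc vs f" "computable_in orc vs g"
  shows "computable_in orc vs (\<lambda>e. prod_encode (f e, g e))"
proof -
  have "computable_in orc vs (\<lambda>e. (f e + g e) * Suc (f e + g e) div 2 + f e)"
    by (intro computable_intros computable_in_div assms) auto
  then show ?thesis by (simp add: prod_encode_def triangle_def)
qed

lemma computable_in_prod_decode:
  assumes "computable_in orc vs f"
  shows "computable_in orc vs (\<lambda>e. fst (prod_decode (f e)))"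
    and "computable_in orc vs (\<lambda>e. snd (prod_decode (f e)))"
proof -
  have *: "prod_encode (i, j) = n \<longleftrightarrow> i = fst (prod_decode n) \<and> j = snd (prod_decode n)" for i j n
    by (metis fst_conv prod.collapse prod_decode_inverse prod_encode_inverse snd_conv)
  have le: "fst (prod_decode n) \<le> n" "snd (prod_decode n) \<le> n" for n
    by (metis le_prod_encode_1 le_prod_encode_2 prod.collapse prod_decode_inverse)+
  have ex: "\<exists>i. \<exists>j\<le>n. prod_encode (i, j) = n" "\<exists>j. \<exists>i\<le>n. prod_encode (i, j) = n" for n
    using le[of n] by (auto simp: *)
  have "computable_in orc vs (\<lambda>e. LEAST i. \<exists>j\<le>f e. prod_encode (i, j) = f e)"
    "computable_in orc vs (\<lambda>e. LEAST j. \<exists>i\<le>f e. prod_encode (i, j) = f e)"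
    by (intro computable_in_Least computable_intros computable_in_prod_encode computable_in_lift
        assms computable_in_rec_vars ex)+
  moreover have "(LEAST i. \<exists>j\<le>n. prod_encode (i, j) = n) = fst (prod_decode n)"
    "(LEAST j. \<exists>i\<le>n. prod_encode (i, j) = n) = snd (prod_decode n)" for n
    using le[of n] by (auto simp: * intro!: Least_equality)
  ultimately show "computable_in orc vs (\<lambda>e. fst (prod_decode (f e)))"
    "computable_in orc vs (\<lambda>e. snd (prod_decode (f e)))" by simp_all
qed

section \<open>Replacing the oracle by a computable function\<close>

text \<open>
  \<open>instantiate_oracle H k n M\<close> is meant for \<open>n\<close> arguments followed by \<open>k\<close> parameters, which are
  handed down to every oracle call, where \<open>H\<close> answers the query.  Since \<open>Prec\<close> and \<open>Mu\<close> put new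
  arguments in front of the list, the parameters have to stand at its end, and their position
  is known only because the number \<open>n\<close> of arguments is tracked.
\<close>

fun instantiate_oracle :: "prog \<Rightarrow> nat \<Rightarrow> nat \<Rightarrow> prog \<Rightarrow> prog" where
  "instantiate_oracle H k n Zero = Zero"
| "instantiate_oracle H k n Succ = Succ"
| "instantiate_oracle H k n (Proj i) = Proj i"
| "instantiate_oracle H k n Oracle = Comp H (Proj 0 # map Proj [n..<n + k])"
| "instantiate_oracle H k n (Comp f gs) =
     Comp (instantiate_oracle H k (length gs) f)
       (map (instantiate_oracle H k n) gs @ map Proj [n..<n + k])"
| "instantiate_oracle H k n (Prec f g) =
     Prec (instantiate_oracle H k (n - 1) f) (instantiate_oracle H k (Suc n) g)"
| "instantiate_oracle H k n (Mu f) = Mu (instantiate_oracle H k (Suc n) f)"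

text \<open>
  This covers terminating computations only: where \<open>M\<close> is undefined because an argument is
  missing, the instantiated program may read a parameter in its place.
\<close>

lemma eval_instantiate_oracle:
  assumes H: "\<And>x. eval p H (x # ps) = Some (r x)"
    and M: "eval r M xs = Some v"
  shows "eval p (instantiate_oracle H (length ps) (length xs) M) (xs @ ps) = Some v"
proof -
  have params: "map (\<lambda>g. the (eval p g (xs @ ps)))
      (map Proj [length xs..<length xs + length ps]) = ps" for xs
    by (rule nth_equalityI) (simp_all add: nth_append)
  show ?thesis using M
  proof (induction M arbitrary: xs v)
    case Zero
    then show ?case by simp
  next
    case Succ
    then show ?case by (cases xs) auto
  next
    case (Proj i)
    then show ?case by (auto simp: nth_append split: if_splits)
  next
    case Oracle
    then obtain x ys where xs: "xs = x # ys" "v = r x" by (cases xs) auto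
    have "map (\<lambda>g. the (eval p g (xs @ ps)))
        (Proj 0 # map Proj [length xs..<length xs + length ps]) = x # ps"
      unfolding list.map(2) params by (simp add: xs)
    then show ?case using H[of x] xs(2)
      by (simp only: instantiate_oracle.simps eval.simps) (auto simp: xs(1))
  next
    case (Comp f gs)
    define ws where "ws = map (\<lambda>g. the (eval r g xs)) gs"
    from Comp.prems have def: "\<forall>g\<in>set gs. eval r g xs \<noteq> None" and f: "eval r f ws = Some v"
      by (auto simp: ws_def split: if_splits)
    have g: "eval p (instantiate_oracle H (length ps) (length xs) g) (xs @ ps) = eval r g xs"
      if "g \<in> set gs" for g
      using Comp.IH(2)[OF that] def that by fastforce
    have vals: "map (\<lambda>g. the (eval p g (xs @ ps)))
        (map (instantiate_oracle H (length ps) (length xs)) gs @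
          map Proj [length xs..<length xs + length ps]) = ws @ ps"
      unfolding map_append params by (simp add: ws_def g)
    have "eval p (instantiate_oracle H (length ps) (length gs) f) (ws @ ps) = Some v"
      using Comp.IH(1)[OF f] by (simp add: ws_def)
    then show ?case using def g
      by (simp only: instantiate_oracle.simps eval.simps vals) auto
  next
    case (Prec f g)
    from Prec.prems obtain n ys where xs: "xs = n # ys" by (cases xs) auto
    let ?R = "rec_nat (eval r f ys)
      (\<lambda>m s. case s of None \<Rightarrow> None | Some v \<Rightarrow> eval r g (m # v # ys))"
    let ?S = "rec_nat (eval p (instantiate_oracle H (length ps) (length ys) f) (ys @ ps))
      (\<lambda>m s. case s of None \<Rightarrow> None
        | Some v \<Rightarrow> eval p (instantiate_oracle H (length ps) (Suc (Suc (length ys))) g)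
            (m # v # ys @ ps))"
    have rec: "?S n = Some w" if "?R n = Some w" for n w
      using that
    proof (induction n arbitrary: w)
      case 0
      then show ?case using Prec.IH(1) by simp
    next
      case (Suc n)
      then obtain u where "?R n = Some u" "eval r g (n # u # ys) = Some w"
        by (auto split: option.splits)
      then have "?S n = Some u"
        "eval p (instantiate_oracle H (length ps) (Suc (Suc (length ys))) g) (n # u # ys @ ps) = Some w"
        using Suc.IH Prec.IH(2)[of "n # u # ys" w] by simp_all
      then show ?case by simp
    qed
    have "?R n = Some v" using Prec.prems by (simp add: xs)
    from rec[OF this] show ?case by (simp add: xs)
  next
    case (Mu f)
    let ?P = "\<lambda>z. eval r f (z # xs) = Some 0 \<and> (\<forall>y<z. eval r f (y # xs) \<noteq> None)"
    let ?f = "instantiate_oracle H (length ps) (Suc (length xs)) f"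
    from Mu.prems obtain z where z: "?P z" and v: "v = (LEAST z. eval r f (z # xs) = Some 0)"
      by (auto split: if_splits)
    have eq: "eval p ?f (y # xs @ ps) = eval r f (y # xs)" if "y \<le> z" for y
    proof -
      have "eval r f (y # xs) \<noteq> None" using z that by (cases "y = z") auto
      then obtain w where "eval r f (y # xs) = Some w" by blast
      then show ?thesis using Mu.IH[of "y # xs" w] by simp
    qed
    have "(LEAST z. eval p ?f (z # xs @ ps) = Some 0) = (LEAST z. eval r f (z # xs) = Some 0)"
    proof (rule Least_equality)
      let ?l = "LEAST z. eval r f (z # xs) = Some 0"
      have l: "?l \<le> z" "eval r f (?l # xs) = Some 0" using z by (auto intro: Least_le LeastI)
      then show "eval p ?f (?l # xs @ ps) = Some 0" by (simp add: eq)
      fix y assume y: "eval p ?f (y # xs @ ps) = Some 0"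
      show "?l \<le> y"
      proof (cases "y \<le> z")
        case True
        then show ?thesis using y eq by (auto intro: Least_le)
      qed (use l in simp)
    qed
    moreover have "eval p ?f (z # xs @ ps) = Some 0 \<and> (\<forall>y<z. eval p ?f (y # xs @ ps) \<noteq> None)"
      using z by (simp add: eq)
    ultimately show ?case using v by auto
  qed
qed

lemma computable_in_instantiate_oracle:
  assumes f: "computable_in fst [snd] (\<lambda>z. f (fst z) (snd z))"
    and h: "computable_in (\<lambda>z. orc (snd z)) (fst # map (\<lambda>v z. v (snd z)) vs)
      (\<lambda>z. h (fst z) (snd z))"
    and n: "computable_in orc vs n"
  shows "computable_in orc vs (\<lambda>e. f (\<lambda>x. h x e) (n e))"
proof -
  obtain M where "\<And>z. eval (fst z) M (map (\<lambda>v. v z) [snd]) = Some (f (fst z) (snd z))"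
    using f unfolding computable_in_def by blast
  from this[of "(r, x)" for r x] have M: "eval r M [x] = Some (f r x)" for r x by simp
  obtain H where "\<And>z. eval (orc (snd z)) H (map (\<lambda>v. v z) (fst # map (\<lambda>v z. v (snd z)) vs)) =
      Some (h (fst z) (snd z))"
    using h unfolding computable_in_def by blast
  from this[of "(x, e)" for x e]
  have H: "eval (orc e) H (x # map (\<lambda>v. v e) vs) = Some (h x e)" for x e by (simp add: comp_def)
  have "eval (orc e) (instantiate_oracle H (length vs) 1 M) (map (\<lambda>v. v e) (n # vs)) =
      Some (f (\<lambda>x. h x e) (n e))" for e
    using eval_instantiate_oracle[OF H M, of e "n e"] by simp
  then have "computable_in orc (n # vs) (\<lambda>e. f (\<lambda>x. h x e) (n e))"
    unfolding computable_in_def by blast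
  from computable_in_subst[OF this, where h = "\<lambda>e. e"] show ?thesis
    using n computable_in_var[of _ vs orc] by auto
qed

section \<open>Cauchy names\<close>

lemma dist_le_of_dist_tendsto_0:
  fixes \<beta> :: "nat \<Rightarrow> 'a::metric_space"
  assumes lim: "(\<lambda>n. dist (\<beta> n) x) \<longlonglongrightarrow> 0" and "\<And>n. n \<ge> k \<Longrightarrow> dist (\<beta> n) (\<beta> k) < \<epsilon>"
  shows "dist (\<beta> k) x \<le> \<epsilon>"
proof -
  have "(\<lambda>n. \<epsilon> + dist (\<beta> n) x) \<longlonglongrightarrow> \<epsilon> + 0" using lim by (intro tendsto_intros)
  moreover have "dist (\<beta> k) x \<le> \<epsilon> + dist (\<beta> n) x" if "n \<ge> k" for n
    using assms(2)[OF that] dist_triangle3[of "\<beta> k" x "\<beta> n"] by simp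
  ultimately show ?thesis using LIMSEQ_le_const by fastforce
qed

lemma cauchy_rep_eq_SomeD:
  assumes "cauchy_rep d \<beta> p = Some x"
    and unique: "\<And>s y z. (\<lambda>n. d (s n) y) \<longlonglongrightarrow> 0 \<Longrightarrow> (\<lambda>n. d (s n) z) \<longlonglongrightarrow> 0 \<Longrightarrow> y = z"
  shows "(\<lambda>n. d (\<beta> (p n)) x) \<longlonglongrightarrow> 0"
    and "k \<le> n \<Longrightarrow> d (\<beta> (p n)) (\<beta> (p k)) < 1 / 2 ^ k"
proof -
  let ?lim = "\<lambda>x. (\<lambda>n. d (\<beta> (p n)) x) \<longlonglongrightarrow> 0"
  let ?cauchy = "\<forall>k. \<forall>n\<ge>k. d (\<beta> (p n)) (\<beta> (p k)) < 1 / 2 ^ k"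
  have *: "(if (\<exists>x. ?lim x) \<and> ?cauchy then Some (THE x. ?lim x) else None) = Some x"
    using assms(1) unfolding cauchy_rep_def .
  have ok: "(\<exists>x. ?lim x) \<and> ?cauchy"
  proof (rule ccontr)
    assume "\<not> ((\<exists>x. ?lim x) \<and> ?cauchy)"
    from *[unfolded if_not_P[OF this]] show False by simp
  qed
  have x: "(THE x. ?lim x) = x" using *[unfolded if_P[OF ok]] by (rule option.inject[THEN iffD1])
  have "\<exists>!x. ?lim x"
    by (rule ex_ex1I[OF conjunct1[OF ok]]) (rule unique[of "\<lambda>n. \<beta> (p n)"])
  then have "?lim (THE x. ?lim x)" by (rule theI')
  then show "?lim x" unfolding x .
  show "d (\<beta> (p n)) (\<beta> (p k)) < 1 / 2 ^ k" if "k \<le> n" using ok that by blast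
qed

lemma cauchy_rep_dist_error:
  fixes \<alpha> :: "nat \<Rightarrow> 'a::metric_space"
  assumes "cauchy_rep dist \<alpha> p = Some x"
  shows "dist (\<alpha> (p k)) x \<le> 1 / 2 ^ k"
proof -
  have "y = z" if "(\<lambda>n. dist (s n) y) \<longlonglongrightarrow> 0" "(\<lambda>n. dist (s n) z) \<longlonglongrightarrow> 0"
    for s :: "nat \<Rightarrow> 'a" and y z
    using that LIMSEQ_unique unfolding tendsto_dist_iff[symmetric] by blast
  note D = cauchy_rep_eq_SomeD[OF assms this]
  show ?thesis using D(1) D(2)[where k = k] by (intro dist_le_of_dist_tendsto_0) auto
qed

text \<open>
  Although \<open>dist_infty\<close> need not satisfy the triangle inequality, it does so for distances below
  \<open>1\<close>, because these occur only within \<open>X\<close> or between \<open>\<infinity>\<close> and itself.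
\<close>

lemma dist_infty_tendsto_0_unique:
  assumes "(\<lambda>n. dist_infty (s n) x) \<longlonglongrightarrow> 0" "(\<lambda>n. dist_infty (s n) y) \<longlonglongrightarrow> 0"
  shows "x = y"
proof -
  have close: "dist_infty x y < 2 * e" if "0 < e" "e \<le> 1" for e
  proof -
    have "\<forall>\<^sub>F n in sequentially. dist_infty (s n) x < e \<and> dist_infty (s n) y < e"
      using assms that by (intro eventually_conj order_tendstoD(2)) auto
    then obtain n where "dist_infty (s n) x < e" "dist_infty (s n) y < e"
      using eventually_happens[of _ sequentially] by force
    then show ?thesis using that dist_triangle3
      by (cases x; cases y; cases "s n") (simp_all, smt (verit) dist_triangle3)
  qed
  show ?thesis
  proof (cases x)
    case (Pt a)
    show ?thesis
    proof (cases y)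
      case (Pt b)
      have "dist a b \<le> 0"
      proof (rule field_le_epsilon)
        fix e :: real assume "0 < e"
        then have "dist a b < 2 * min 1 (e / 2)"
          using close[of "min 1 (e / 2)"] Pt \<open>x = Pt a\<close> by simp
        then show "dist a b \<le> 0 + e" by simp
      qed
      then show ?thesis using Pt \<open>x = Pt a\<close> by simp
    qed (use close[of "1 / 2"] Pt in simp)
  next
    case Infty
    then show ?thesis using close[of "1 / 2"] by (cases y) auto
  qed
qed

text \<open>
  A name never mixes \<open>\<infinity>\<close> with points of \<open>X\<close>, as their distance is not below \<open>1/2\<^sup>0\<close>.  So each single
  entry of a name reveals whether a point of \<open>X\<close> is meant.
\<close>

lemma cauchy_rep_infty_SomeD:
  fixes \<alpha> :: "nat \<Rightarrow> 'a::metric_space"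
  assumes "cauchy_rep dist_infty (dense_infty \<alpha>) p = Some x"
  shows "p k = Suc n \<Longrightarrow> \<exists>a. x = Pt a \<and> dist (\<alpha> n) a \<le> 1 / 2 ^ k"
    and "x = Pt a \<Longrightarrow> p k \<noteq> 0"
proof -
  note lim = cauchy_rep_eq_SomeD(1)[OF assms dist_infty_tendsto_0_unique]
  note cauchy = cauchy_rep_eq_SomeD(2)[OF assms dist_infty_tendsto_0_unique]
  have mix: "p n = 0 \<longleftrightarrow> p 0 = 0" for n
    using cauchy[where k = 0 and n = n] by (cases "p n"; cases "p 0") auto
  have Infty: "x = Infty" if "p 0 = 0"
    using lim mix that by (cases x) (simp_all add: LIMSEQ_const_iff)
  have Pt: "\<exists>a. x = Pt a \<and> (\<forall>k. dist (\<alpha> (p k - 1)) a \<le> 1 / 2 ^ k)" if "p 0 \<noteq> 0"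
  proof -
    have p: "dense_infty \<alpha> (p n) = Pt (\<alpha> (p n - 1))" for n
      using mix[of n] that by (cases "p n") auto
    show ?thesis
    proof (cases x)
      case (Pt a)
      then have "dist (\<alpha> (p k - 1)) a \<le> 1 / 2 ^ k" for k
        using lim cauchy unfolding p by (intro dist_le_of_dist_tendsto_0) auto
      then show ?thesis using Pt by blast
    qed (use lim in \<open>simp add: p LIMSEQ_const_iff\<close>)
  qed
  show "\<exists>a. x = Pt a \<and> dist (\<alpha> n) a \<le> 1 / 2 ^ k" if "p k = Suc n"
    using Pt mix[of k] that by (metis diff_Suc_1 nat.distinct(1))
  show "p k \<noteq> 0" if "x = Pt a" using Infty mix[of k] that by auto
qed

lemma cauchy_rep_infty_const:
  "cauchy_rep dist_infty (dense_infty \<alpha>) (\<lambda>_. n) = Some (dense_infty \<alpha> n)"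
proof -
  have lim: "(\<lambda>_::nat. dist_infty (dense_infty \<alpha> n) (dense_infty \<alpha> n)) \<longlonglongrightarrow> 0"
    and zero: "dist_infty (dense_infty \<alpha> n) (dense_infty \<alpha> n) = 0"
    by (cases n; simp)+
  have the: "(THE x. (\<lambda>_::nat. dist_infty (dense_infty \<alpha> n) x) \<longlonglongrightarrow> 0) = dense_infty \<alpha> n"
    by (rule the_equality) (rule lim, rule dist_infty_tendsto_0_unique[OF _ lim])
  have "\<exists>x. (\<lambda>_::nat. dist_infty (dense_infty \<alpha> n) x) \<longlonglongrightarrow> 0" using lim by blast
  then show ?thesis by (simp add: cauchy_rep_def the zero)
qed

lemma baire_tendsto_iff:
  fixes s :: "nat \<Rightarrow> nat \<Rightarrow> nat"
  shows "s \<longlonglongrightarrow> q \<longleftrightarrow> (\<forall>j. \<forall>\<^sub>F n in sequentially. s n j = q j)"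
proof (intro iffI allI)
  fix j assume "s \<longlonglongrightarrow> q"
  then show "\<forall>\<^sub>F n in sequentially. s n j = q j" by (rule baire_tendsto_imp_eventually)
next
  assume "\<forall>j. \<forall>\<^sub>F n in sequentially. s n j = q j"
  then have "(\<lambda>n. s n j) \<longlonglongrightarrow> q j" for j by (simp add: tendsto_eventually)
  then have "limitin (product_topology (\<lambda>_. euclidean) UNIV) s q sequentially"
    by (simp add: limitin_componentwise)
  then show "s \<longlonglongrightarrow> q" by (simp add: euclidean_product_topology)
qed

lemma ex_inverse_power2_less:
  fixes \<epsilon> :: real
  assumes "0 < \<epsilon>"
  obtains k where "\<And>k'. k \<le> k' \<Longrightarrow> 1 / 2 ^ k' < \<epsilon>"
proof -
  obtain k where k: "(1 / 2) ^ k < \<epsilon>" using real_arch_pow_inv[OF assms, of "1 / 2"] by auto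
  have "1 / 2 ^ k' < \<epsilon>" if "k \<le> k'" for k'
  proof -
    have "1 / 2 ^ k' \<le> (1 / 2 ^ k :: real)" using that by (simp add: field_simps)
    then show ?thesis using k by (simp add: power_one_over)
  qed
  then show thesis by (rule that)
qed

section \<open>A decidable formal inclusion of balls\<close>

text \<open>
  Soundness and completeness do not match exactly: when the larger ball leaves between \<open>1/2\<^sup>k\<close> and
  \<open>3/2\<^sup>k\<close> of room, \<open>I\<close> may hold or fail.  This gap is what makes decidability possible.
\<close>

locale formal_inclusion =
  fixes \<alpha> :: "nat \<Rightarrow> 'a::metric_space" and I :: "nat \<Rightarrow> nat \<Rightarrow> nat \<Rightarrow> bool"
  assumes dense: "closure (range \<alpha>) = UNIV"
    and sound: "I n m k \<Longrightarrow> dist (\<alpha> n) x \<le> 1 / 2 ^ k \<Longrightarrow> x \<in> basic_ball \<alpha> m"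
    and complete: "dist (\<alpha> n) (\<alpha> c) + 3 / 2 ^ k < rat_enum r \<Longrightarrow> I n (prod_encode (c, r)) k"

definition decidable3 :: "(nat \<Rightarrow> nat \<Rightarrow> nat \<Rightarrow> bool) \<Rightarrow> bool" where
  "decidable3 I \<longleftrightarrow> decidable_in fst
     [\<lambda>z. fst (snd z), \<lambda>z. fst (snd (snd z)), \<lambda>z. snd (snd (snd z))]
     (\<lambda>z. I (fst (snd z)) (fst (snd (snd z))) (snd (snd (snd z))))"

lemma decidable_in_decidable3:
  assumes "decidable3 I"
    and "computable_in orc vs f" "computable_in orc vs g" "computable_in orc vs h"
  shows "decidable_in orc vs (\<lambda>e. I (f e) (g e) (h e))"
proof -
  let ?h = "\<lambda>e. (orc e, f e, g e, h e)"
  have "computable_in (\<lambda>e. fst (?h e)) vs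
      (\<lambda>e. of_bool (I (fst (snd (?h e))) (fst (snd (snd (?h e)))) (snd (snd (snd (?h e))))))"
    by (rule computable_in_subst[OF assms(1)[unfolded decidable3_def decidable_in_def],
          where h = ?h]) (use assms(2-4) in auto)
  then show ?thesis by (simp add: decidable_in_def)
qed

text \<open>
  Clearing denominators and moving subtracted terms to the other side leaves an inequality between
  natural numbers.
\<close>

lemma decidable_in_rat_enum_less:
  assumes "computable_in orc vs f" "computable_in orc vs g" "computable_in orc vs h"
  shows "decidable_in orc vs (\<lambda>e. rat_enum (f e) + 2 / 2 ^ h e < rat_enum (g e))"
proof -
  define num where "num n = fst (prod_decode n)" for n
  define sub where "sub n = fst (prod_decode (snd (prod_decode n)))" for n
  define den where "den n = Suc (snd (prod_decode (snd (prod_decode n))))" for n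
  have rat: "rat_enum n = (real (num n) - real (sub n)) / real (den n)" and den: "den n > 0" for n
    by (simp_all add: rat_enum_def num_def sub_def den_def split: prod.split)
  have "rat_enum a + 2 / 2 ^ k < rat_enum b \<longleftrightarrow>
      num a * den b * 2 ^ k + 2 * den a * den b + sub b * den a * 2 ^ k
        < num b * den a * 2 ^ k + sub a * den b * 2 ^ k" (is "?L \<longleftrightarrow> ?m < ?n") for a b k
  proof -
    let ?c = "real (den a) * real (den b) * 2 ^ k"
    have c: "?c > 0" using den by simp
    have "(rat_enum a + 2 / 2 ^ k) * ?c = (real (num a) - real (sub a)) * real (den b) * 2 ^ k
        + 2 * real (den a) * real (den b)"
      using den[of a] den[of b] by (simp add: rat field_simps)
    moreover have "rat_enum b * ?c = (real (num b) - real (sub b)) * real (den a) * 2 ^ k"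
      using den[of a] den[of b] by (simp add: rat field_simps)
    moreover have "?L \<longleftrightarrow> (rat_enum a + 2 / 2 ^ k) * ?c < rat_enum b * ?c"
      using mult_less_cancel_right_pos[OF c] by blast
    ultimately have "?L \<longleftrightarrow> real ?m < real ?n"
      by (simp only:) (simp add: algebra_simps)
    then show ?thesis by (simp only: of_nat_less_iff)
  qed
  moreover have "decidable_in orc vs (\<lambda>e.
      num (f e) * den (g e) * 2 ^ h e + 2 * den (f e) * den (g e) + sub (g e) * den (f e) * 2 ^ h e
        < num (g e) * den (f e) * 2 ^ h e + sub (f e) * den (g e) * 2 ^ h e)"
    unfolding num_def sub_def den_def
    by (intro computable_intros computable_in_prod_decode assms)
  ultimately show ?thesis by simp
qed

text \<open>
  The hypothesis yields a program that computes \<open>dist (\<alpha> i) (\<alpha> j)\<close> from an oracle which answers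
  \<open>i\<close> to the query \<open>0\<close> and \<open>j\<close> to the query \<open>1\<close>.  Substituting this oracle gives a computable
  approximation \<open>D i j k\<close> with error at most \<open>1/2\<^sup>k\<close>, and the relation sought is an inequality
  for \<open>D\<close>.
\<close>

lemma ex_decidable_formal_inclusion:
  assumes "computable_metric_space \<alpha>"
  obtains I where "formal_inclusion \<alpha> I" "decidable3 I"
proof -
  obtain F where F: "computable_baire F"
    "realizes F nat_pair_rep real_rep (\<lambda>(i, j). dist (\<alpha> i) (\<alpha> j))"
    using assms unfolding computable_metric_space_def computable_map_def by blast
  then obtain M where "\<And>p q n. F p = Some q \<Longrightarrow> eval p M [n] = Some (q n)"
    unfolding computable_baire_def by blast
  then have "\<exists>q. (\<forall>n. eval p M [n] = Some (q n)) \<and> real_rep q = Some (dist (\<alpha> (p 0)) (\<alpha> (p 1)))" for p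
    using F(2) unfolding realizes_def nat_pair_rep_def by fastforce
  then obtain G where G: "\<And>p n. eval p M [n] = Some (G p n)"
    "\<And>p. real_rep (G p) = Some (dist (\<alpha> (p 0)) (\<alpha> (p 1)))"
    by metis
  define D where "D i j k = G (\<lambda>x. if x = 0 then i else j) k" for i j k
  have D: "\<bar>rat_enum (D i j k) - dist (\<alpha> i) (\<alpha> j)\<bar> \<le> 1 / 2 ^ k" for i j k
    using cauchy_rep_dist_error[OF G(2)[unfolded real_rep_def], of "\<lambda>x. if x = 0 then i else j" k]
    by (simp add: D_def dist_real_def)
  have "computable_in fst [snd] (\<lambda>z. G (fst z) (snd z))"
    unfolding computable_in_def using G(1) by auto
  note computable_D = computable_in_instantiate_oracle[OF this]
  define I where "I n m k \<longleftrightarrow>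
      rat_enum (D n (fst (prod_decode m)) k) + 2 / 2 ^ k < rat_enum (snd (prod_decode m))" for n m k
  show thesis
  proof
    show "formal_inclusion \<alpha> I"
    proof
      show "closure (range \<alpha>) = UNIV" using assms by (simp add: computable_metric_space_def)
    next
      fix n m k x assume I: "I n m k" and x: "dist (\<alpha> n) x \<le> 1 / 2 ^ k"
      obtain c r where m: "prod_decode m = (c, r)" by fastforce
      have "dist (\<alpha> c) x \<le> dist (\<alpha> n) (\<alpha> c) + 1 / 2 ^ k"
        using dist_triangle3[of "\<alpha> c" x "\<alpha> n"] x by simp
      also have "\<dots> < rat_enum r"
        using I D[of n c k] by (simp add: I_def m abs_le_iff field_simps)
      finally show "x \<in> basic_ball \<alpha> m" by (simp add: basic_ball_def m)
    next
      fix n c k r assume "dist (\<alpha> n) (\<alpha> c) + 3 / 2 ^ k < rat_enum r"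
      then show "I n (prod_encode (c, r)) k"
        using D[of n c k] by (simp add: I_def abs_le_iff field_simps)
    qed
    show "decidable3 I"
      unfolding decidable3_def I_def D_def
      by (intro decidable_in_rat_enum_less computable_D computable_in_if decidable_in_eq
          computable_in_const computable_in_prod_decode computable_in_lift computable_in_rec_vars(1))
        (simp_all add: computable_in_var)
  qed
qed

section \<open>Enumerating the balls that are finally avoided, in the limit\<close>

lemma basic_ball_0: "basic_ball \<alpha> 0 = {}"
proof -
  have "prod_decode 0 = (0, 0)" by (simp add: prod_decode_def prod_decode_aux.simps)
  then show ?thesis by (simp add: basic_ball_def rat_enum_def)
qed

text \<open>
  Stage \<open>s\<close> of entry \<open>\<langle>m, N\<rangle>\<close>: the code \<open>m\<close>, unless the point named by \<open>component p i\<close>, for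
  some \<open>i\<close> with \<open>N \<le> i \<le> s\<close>, has been found in the ball with code \<open>m\<close>.  The code \<open>0\<close>
  denotes the empty ball.  In names of points, \<open>0\<close> stands for \<open>\<infinity>\<close> and \<open>Suc n\<close> for \<open>\<alpha> n\<close>, hence the predecessor.
\<close>

definition avoided_balls :: "(nat \<Rightarrow> nat \<Rightarrow> nat \<Rightarrow> bool) \<Rightarrow> (nat \<Rightarrow> nat) \<Rightarrow> nat \<Rightarrow> nat" where
  "avoided_balls I p z =
     (let s = fst (prod_decode z); m = fst (prod_decode (snd (prod_decode z)));
        N = snd (prod_decode (snd (prod_decode z)))
      in if \<forall>i\<le>s. N \<le> i \<longrightarrow>
            (\<forall>j\<le>s. component p i j \<noteq> 0 \<longrightarrow> \<not> I (component p i j - 1) m j)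
         then m else 0)"

lemma computable_avoided_balls:
  assumes "decidable3 I"
  shows "computable_in fst [snd] (\<lambda>z. avoided_balls I (fst z) (snd z))"
  unfolding avoided_balls_def Let_def component_def
  by (intro computable_intros decidable_in_decidable3[OF assms] computable_in_prod_encode
      computable_in_prod_decode computable_in_oracle)
    (simp_all add: computable_in_var)

context formal_inclusion
begin

text \<open>
  Membership in a basic ball is open, so it is certified by a sufficiently precise entry of the
  name.
\<close>

lemma ex_formal_inclusion_iff_mem_ball:
  assumes "cauchy_rep dist_infty (dense_infty \<alpha>) p = Some x"
  shows "(\<exists>j. p j \<noteq> 0 \<and> I (p j - 1) m j) \<longleftrightarrow> x \<in> Pt ` basic_ball \<alpha> m"
proof
  assume "\<exists>j. p j \<noteq> 0 \<and> I (p j - 1) m j"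
  then obtain j n where j: "p j = Suc n" "I n m j" by (auto simp: gr0_conv_Suc)
  then obtain a where "x = Pt a" "dist (\<alpha> n) a \<le> 1 / 2 ^ j"
    using cauchy_rep_infty_SomeD(1)[OF assms] by blast
  then show "x \<in> Pt ` basic_ball \<alpha> m" using sound[OF j(2)] by auto
next
  assume "x \<in> Pt ` basic_ball \<alpha> m"
  then obtain a where a: "x = Pt a" "a \<in> basic_ball \<alpha> m" by auto
  obtain c r where m: "m = prod_encode (c, r)" by (metis prod.collapse prod_decode_inverse)
  then have "0 < (rat_enum r - dist (\<alpha> c) a) / 4" using a by (simp add: basic_ball_def)
  then obtain j where "1 / 2 ^ j < (rat_enum r - dist (\<alpha> c) a) / 4"
    using ex_inverse_power2_less by blast
  then have j: "dist (\<alpha> c) a + 4 * (1 / 2 ^ j) < rat_enum r" by simp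
  obtain n where n: "p j = Suc n"
    using cauchy_rep_infty_SomeD(2)[OF assms a(1)] not0_implies_Suc by blast
  then have "dist (\<alpha> n) a \<le> 1 / 2 ^ j"
    using cauchy_rep_infty_SomeD(1)[OF assms n] a(1) by auto
  then have "dist (\<alpha> n) (\<alpha> c) + 3 / 2 ^ j < rat_enum r"
    using j dist_triangle2[of "\<alpha> n" "\<alpha> c" a] by simp
  then have "I n m j" unfolding m by (rule complete)
  then show "\<exists>j. p j \<noteq> 0 \<and> I (p j - 1) m j" using n by (intro exI[of _ j]) simp
qed

theorem psi_minus_jump_avoided_balls:
  assumes "psi_star \<alpha> p = Some A"
  shows "psi_minus_jump \<alpha> (avoided_balls I p) = Some A"
proof -
  define x where "x i = the (cauchy_rep dist_infty (dense_infty \<alpha>) (component p i))" for i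
  have dom: "component p i \<in> dom (cauchy_rep dist_infty (dense_infty \<alpha>))" for i
    using assms unfolding psi_star_def seq_rep_def by (auto split: if_splits)
  then have x: "cauchy_rep dist_infty (dense_infty \<alpha>) (component p i) = Some (x i)" for i
    by (simp add: x_def domIff)
  have A: "A = Pt -` cluster_points dist_infty x"
    using assms dom unfolding psi_star_def seq_rep_def x_def by simp
  define meets where "meets m i \<longleftrightarrow> (\<exists>j. component p i j \<noteq> 0 \<and> I (component p i j - 1) m j)" for m i
  have meets_iff: "meets m i \<longleftrightarrow> x i \<in> Pt ` basic_ball \<alpha> m" for m i
    unfolding meets_def by (rule ex_formal_inclusion_iff_mem_ball[OF x])
  define q where "q w = (case prod_decode w of (m, N) \<Rightarrow> if \<forall>i\<ge>N. \<not> meets m i then m else 0)" for w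
  have "component (avoided_balls I p) \<longlonglongrightarrow> q"
    unfolding baire_tendsto_iff
  proof
    fix w
    obtain m N where w: "prod_decode w = (m, N)" by fastforce
    have eq: "component (avoided_balls I p) s w = (if \<forall>i\<le>s. N \<le> i \<longrightarrow>
        (\<forall>j\<le>s. component p i j \<noteq> 0 \<longrightarrow> \<not> I (component p i j - 1) m j) then m else 0)" for s
      unfolding component_def[of "avoided_balls I p"] by (simp add: avoided_balls_def w)
    show "\<forall>\<^sub>F s in sequentially. component (avoided_balls I p) s w = q w"
    proof (cases "\<forall>i\<ge>N. \<not> meets m i")
      case True
      have "component (avoided_balls I p) s w = q w" for s
      proof -
        have "\<forall>i\<le>s. N \<le> i \<longrightarrow>
            (\<forall>j\<le>s. component p i j \<noteq> 0 \<longrightarrow> \<not> I (component p i j - 1) m j)"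
          using True unfolding meets_def by blast
        then show ?thesis using True unfolding eq q_def w by simp
      qed
      then show ?thesis by simp
    next
      case False
      then obtain i j where ij: "N \<le> i" "component p i j \<noteq> 0" "I (component p i j - 1) m j"
        unfolding meets_def by blast
      (* From stage max i j on, the entry i together with its approximation j has been seen. *)
      have "component (avoided_balls I p) s w = q w" if "max i j \<le> s" for s
      proof -
        have "\<not> (\<forall>i\<le>s. N \<le> i \<longrightarrow>
            (\<forall>j\<le>s. component p i j \<noteq> 0 \<longrightarrow> \<not> I (component p i j - 1) m j))"
          using ij that by fastforce
        then show ?thesis using False by (simp only: eq q_def w prod.case if_False)
      qed
      then show ?thesis unfolding eventually_sequentially by blast
    qed
  qed
  then have lim: "baire_lim (avoided_balls I p) = Some q" by (simp add: baire_lim_eq_Some_iff)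
  have "(\<Union>w. basic_ball \<alpha> (q w)) = - A"
  proof (intro equalityI subsetI)
    fix a assume "a \<in> (\<Union>w. basic_ball \<alpha> (q w))"
    then obtain w where a: "a \<in> basic_ball \<alpha> (q w)" by blast
    obtain m N where w: "prod_decode w = (m, N)" by fastforce
    have m: "q w = m" and N: "\<And>i. i \<ge> N \<Longrightarrow> \<not> meets m i"
      using a by (auto simp: q_def w basic_ball_0 split: if_splits)
    obtain e where e: "e > 0" "ball a e \<subseteq> basic_ball \<alpha> m"
      using a m openE[of "basic_ball \<alpha> m" a] by (auto simp: basic_ball_def split: prod.splits)
    (* The bound 1 excludes the entries that are \<infinity>. *)
    have "i < N" if i: "dist_infty (x i) (Pt a) < min e 1" for i
    proof (cases "x i")
      case (Pt b)
      then have "b \<in> basic_ball \<alpha> m" using i e(2) by (auto simp: dist_commute)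
      then have "meets m i" by (simp add: meets_iff Pt)
      then show ?thesis using N[of i] by (auto simp: not_le[symmetric])
    qed (use i in simp)
    then have "{i. dist_infty (x i) (Pt a) < min e 1} \<subseteq> {..<N}" by blast
    then have "finite {i. dist_infty (x i) (Pt a) < min e 1}" by (rule finite_subset) simp
    moreover have "0 < min e 1" using e by simp
    ultimately have "Pt a \<notin> cluster_points dist_infty x" unfolding cluster_points_def by blast
    then show "a \<in> - A" by (simp add: A)
  next
    fix a assume "a \<in> - A"
    then obtain e where e: "e > 0" "finite {i. dist_infty (x i) (Pt a) < e}"
      unfolding A cluster_points_def by auto
    then obtain N where N: "\<And>i. dist_infty (x i) (Pt a) < e \<Longrightarrow> i < N"
      unfolding finite_nat_set_iff_bounded by blast
    obtain n where n: "dist (\<alpha> n) a < e / 4" using dense_ex[OF dense, of "e / 4" a] e by auto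
    obtain r where r: "r \<in> \<rat>" "e / 4 < r" "r < e / 2"
      using Rats_dense_in_real[of "e / 4" "e / 2"] e by auto
    obtain k where k: "rat_enum k = r" using rat_enum_surj r by blast
    define m where "m = prod_encode (n, k)"
    have "\<not> meets m i" if "i \<ge> N" for i
    proof
      assume "meets m i"
      then obtain b where b: "x i = Pt b" "dist (\<alpha> n) b < r"
        unfolding meets_iff by (auto simp: m_def basic_ball_def k)
      then have "dist b a < e" using n r dist_triangle3[of b a "\<alpha> n"] by simp
      then show False using N[of i] b that by simp
    qed
    then have "q (prod_encode (m, N)) = m" by (simp add: q_def)
    moreover have "a \<in> basic_ball \<alpha> m" using n r by (simp add: m_def basic_ball_def k)
    ultimately show "a \<in> (\<Union>w. basic_ball \<alpha> (q w))" by (metis UN_I UNIV_I)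
  qed
  then show ?thesis
    unfolding psi_minus_jump_def by (simp add: lim psi_minus_def Compl_eq_Diff_UNIV[symmetric])
qed

end

section \<open>Greedy separated sets of natural numbers\<close>

text \<open>
  Going through the numbers in increasing order, \<open>n\<close> is selected if it satisfies \<open>P\<close> and is not
  related by \<open>R\<close> to a smaller selected number.  The set of the numbers selected so far is kept as
  a single number, its code in the sense of \<open>set_decode\<close>, so that the recursion is one on numbers.
\<close>

primrec greedy_code :: "(nat \<Rightarrow> bool) \<Rightarrow> (nat \<Rightarrow> nat \<Rightarrow> bool) \<Rightarrow> nat \<Rightarrow> nat" where
  "greedy_code P R 0 = 0"
| "greedy_code P R (Suc n) =
     (if P n \<and> (\<forall>j<n. j \<in> set_decode (greedy_code P R n) \<longrightarrow> \<not> R n j)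
      then 2 ^ n + greedy_code P R n else greedy_code P R n)"

definition greedy_set :: "(nat \<Rightarrow> bool) \<Rightarrow> (nat \<Rightarrow> nat \<Rightarrow> bool) \<Rightarrow> nat set" where
  "greedy_set P R = {n. n \<in> set_decode (greedy_code P R (Suc n))}"

lemma set_decode_greedy_code: "set_decode (greedy_code P R n) = greedy_set P R \<inter> {..<n}"
proof (induction n)
  case 0
  then show ?case by simp
next
  case (Suc n)
  have n: "n \<notin> set_decode (greedy_code P R n)" by (simp add: Suc.IH)
  have "set_decode (greedy_code P R (Suc n)) - {n} = set_decode (greedy_code P R n)"
    using n by (auto simp: set_decode_plus_power_2[OF n])
  moreover have "n \<in> set_decode (greedy_code P R (Suc n)) \<longleftrightarrow> n \<in> greedy_set P R"
    by (simp only: greedy_set_def mem_Collect_eq)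
  ultimately show ?case unfolding Suc.IH by (auto simp: lessThan_Suc simp del: greedy_code.simps)
qed

lemma mem_greedy_set_iff:
  "n \<in> greedy_set P R \<longleftrightarrow> P n \<and> (\<forall>j<n. j \<in> greedy_set P R \<longrightarrow> \<not> R n j)"
proof -
  have n: "n \<notin> set_decode (greedy_code P R n)" by (simp add: set_decode_greedy_code)
  have "n \<in> greedy_set P R \<longleftrightarrow>
      P n \<and> (\<forall>j<n. j \<in> set_decode (greedy_code P R n) \<longrightarrow> \<not> R n j)"
    using n by (auto simp: greedy_set_def set_decode_plus_power_2[OF n])
  also have "\<dots> \<longleftrightarrow> P n \<and> (\<forall>j<n. j \<in> greedy_set P R \<longrightarrow> \<not> R n j)"
    by (simp add: set_decode_greedy_code)
  finally show ?thesis .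
qed

lemma decidable_in_greedy_set:
  assumes n: "computable_in orc vs n"
    and P: "decidable_in (\<lambda>z. orc (snd z)) (fst # map (\<lambda>v z. v (snd z)) vs)
      (\<lambda>z. P (snd z) (fst z))"
    and R: "decidable_in (\<lambda>z. orc (snd (snd z)))
      (fst # (\<lambda>z. fst (snd z)) # map (\<lambda>v z. v (snd (snd z))) vs)
      (\<lambda>z. R (snd (snd z)) (fst z) (fst (snd z)))"
  shows "decidable_in orc vs (\<lambda>e. n e \<in> greedy_set (P e) (R e))"
proof -
  let ?step = "\<lambda>e m r. if P e m \<and> (\<forall>j<m. j \<in> set_decode r \<longrightarrow> \<not> R e m j)
    then 2 ^ m + r else r"
  have code: "rec_nat 0 (?step e) k = greedy_code (P e) (R e) k" for e k
    by (induction k) simp_all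
  let ?ws = "fst # (\<lambda>z. fst (snd z)) # map (\<lambda>v z. v (snd (snd z))) vs"
  have P': "decidable_in (\<lambda>z. orc (snd (snd z))) ?ws (\<lambda>z. P (snd (snd z)) (fst z))"
  proof -
    have "computable_in (\<lambda>z. orc (snd (fst z, snd (snd z)))) ?ws
        (\<lambda>z. of_bool (P (snd (fst z, snd (snd z))) (fst (fst z, snd (snd z)))))"
      by (rule computable_in_subst[OF P[unfolded decidable_in_def],
            where h = "\<lambda>z. (fst z, snd (snd z))"]) (auto intro: computable_in_var)
    then show ?thesis by (simp add: decidable_in_def)
  qed
  have R': "decidable_in (\<lambda>z. orc (snd (snd (snd z)))) (fst # map (\<lambda>v z. v (snd z)) ?ws)
      (\<lambda>z. R (snd (snd (snd z))) (fst (snd z)) (fst z))"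
  proof -
    let ?h = "\<lambda>z. (fst (snd z), fst z, snd (snd (snd z)))"
    have "computable_in (\<lambda>z. orc (snd (snd (?h z)))) (fst # map (\<lambda>v z. v (snd z)) ?ws)
        (\<lambda>z. of_bool (R (snd (snd (?h z))) (fst (?h z)) (fst (snd (?h z)))))"
      by (rule computable_in_subst[OF R[unfolded decidable_in_def], where h = ?h])
        (auto intro: computable_in_var)
    then show ?thesis by (simp add: decidable_in_def)
  qed
  have "computable_in orc vs (\<lambda>e. rec_nat 0 (?step e) (Suc (n e)))"
    by (intro computable_in_rec computable_intros decidable_in_set_decode n P' R'
        computable_in_rec_vars computable_in_lift)
  then show ?thesis
    unfolding greedy_set_def mem_Collect_eq code by (intro decidable_in_set_decode n)
qed

section \<open>A sequence that clusters at the complement of a limit of enumerated balls\<close>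

definition consistent :: "(nat \<Rightarrow> nat \<Rightarrow> nat \<Rightarrow> bool) \<Rightarrow> (nat \<Rightarrow> nat) \<Rightarrow> nat \<Rightarrow> nat \<Rightarrow> bool" where
  "consistent I q k n \<longleftrightarrow> (\<forall>i\<le>k. \<not> I n (q i) k)"

text \<open>
  The inner code denotes the rational \<open>4/2\<^sup>k\<close>, so this expresses that \<open>\<alpha> n\<close> is formally inside
  the ball of radius \<open>4/2\<^sup>k\<close> around \<open>\<alpha> j\<close>.
\<close>

definition near :: "(nat \<Rightarrow> nat \<Rightarrow> nat \<Rightarrow> bool) \<Rightarrow> nat \<Rightarrow> nat \<Rightarrow> nat \<Rightarrow> bool" where
  "near I k n j \<longleftrightarrow> I n (prod_encode (j, prod_encode (4, prod_encode (0, 2 ^ k - 1)))) k"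

definition net :: "(nat \<Rightarrow> nat \<Rightarrow> nat \<Rightarrow> bool) \<Rightarrow> (nat \<Rightarrow> nat) \<Rightarrow> nat \<Rightarrow> nat set" where
  "net I q k = greedy_set (consistent I q k) (near I k)"

lemma mem_net_iff:
  "n \<in> net I q k \<longleftrightarrow> consistent I q k n \<and> (\<forall>j<n. j \<in> net I q k \<longrightarrow> \<not> near I k n j)"
  unfolding net_def by (rule mem_greedy_set_iff)

text \<open>
  The entry at \<open>\<langle>\<langle>n, k\<rangle>, t\<rangle>\<close> treats the candidate \<open>n\<close> of the net with precision \<open>k\<close> at stage
  \<open>s = \<langle>n, k\<rangle> + t\<close>.  The stages start at \<open>\<langle>n, k\<rangle>\<close> so that, for given \<open>k\<close>, only finitely many candidates
  are ever treated with a wrong approximation of the limit.  The candidate is entered at its first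
  stage and whenever the relevant part of the approximation changes: thus finitely often in
  total, but also at least once with the final approximation.
\<close>

definition net_sequence :: "(nat \<Rightarrow> nat \<Rightarrow> nat \<Rightarrow> bool) \<Rightarrow> (nat \<Rightarrow> nat) \<Rightarrow> nat \<Rightarrow> nat" where
  "net_sequence I p w =
     (let m = fst (prod_decode w); t = snd (prod_decode w); s = m + t;
        n = fst (prod_decode m); k = snd (prod_decode m)
      in if (t = 0 \<or> (\<exists>i\<le>k. component p (s - 1) i \<noteq> component p s i)) \<and> n \<in> net I (component p s) k
         then Suc n else 0)"

definition net_sequence_name :: "(nat \<Rightarrow> nat \<Rightarrow> nat \<Rightarrow> bool) \<Rightarrow> (nat \<Rightarrow> nat) \<Rightarrow> nat \<Rightarrow> nat" where
  "net_sequence_name I p z = net_sequence I p (fst (prod_decode z))"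

lemma computable_net_sequence_name:
  assumes "decidable3 I"
  shows "computable_in fst [snd] (\<lambda>z. net_sequence_name I (fst z) (snd z))"
  unfolding net_sequence_name_def net_sequence_def Let_def net_def consistent_def near_def component_def
  by (intro computable_intros decidable_in_greedy_set decidable_in_decidable3[OF assms]
      computable_in_prod_encode computable_in_prod_decode computable_in_oracle)
    (simp_all add: computable_in_var)

context formal_inclusion
begin

lemma far_of_not_near:
  assumes "\<not> near I k n j"
  shows "1 / 2 ^ k \<le> dist (\<alpha> n) (\<alpha> j)"
proof (rule ccontr)
  assume "\<not> 1 / 2 ^ k \<le> dist (\<alpha> n) (\<alpha> j)"
  then have "dist (\<alpha> n) (\<alpha> j) + 3 / 2 ^ k < rat_enum (prod_encode (4, prod_encode (0, 2 ^ k - 1)))"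
    by (simp add: rat_enum_def of_nat_diff)
  then show False using assms complete by (simp add: near_def)
qed

lemma dist_less_of_near:
  assumes "near I k n j" "dist (\<alpha> n) a \<le> 1 / 2 ^ k"
  shows "dist (\<alpha> j) a < 4 / 2 ^ k"
  using sound[OF assms(1)[unfolded near_def] assms(2)]
  by (simp add: basic_ball_def rat_enum_def of_nat_diff)

lemma consistent_of_close:
  assumes "a \<notin> (\<Union>i. basic_ball \<alpha> (q i))" "dist (\<alpha> n) a \<le> 1 / 2 ^ k"
  shows "consistent I q k n"
  using assms sound unfolding consistent_def by blast

text \<open>
  A consistent dense point close to \<open>a\<close> exists by density; if it was not selected, then an
  earlier selected point is near to it.
\<close>

lemma ex_close_in_net:
  assumes "a \<notin> (\<Union>i. basic_ball \<alpha> (q i))"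
  shows "\<exists>n \<in> net I q k. dist (\<alpha> n) a < 4 / 2 ^ k"
proof -
  obtain n where n: "dist (\<alpha> n) a < 1 / 2 ^ k" using dense_ex[OF dense, of "1 / 2 ^ k" a] by auto
  show ?thesis
  proof (cases "n \<in> net I q k")
    case True
    have "1 / 2 ^ k \<le> (4 / 2 ^ k :: real)" by (simp add: divide_right_mono)
    with n have "dist (\<alpha> n) a < 4 / 2 ^ k" by (rule less_le_trans)
    then show ?thesis using True by blast
  next
    case False
    then obtain j where "j \<in> net I q k" "near I k n j"
      using consistent_of_close[OF assms] n mem_net_iff[of n I q k] by auto
    then show ?thesis using dist_less_of_near[of k n j a] n by auto
  qed
qed

text \<open>
  Points of the net that are closer than \<open>\<epsilon>\<close> to \<open>x\<close> are closer than \<open>1/2\<^sup>k\<close> to each other, so there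
  is at most one.
\<close>

lemma finite_net_close:
  assumes "\<epsilon> \<le> 1 / 2 ^ Suc k"
  shows "finite {n \<in> net I q k. dist (\<alpha> n) x < \<epsilon>}"
proof -
  have sep: False
    if "n \<in> net I q k" "j \<in> net I q k" "j < n" "dist (\<alpha> n) x < \<epsilon>" "dist (\<alpha> j) x < \<epsilon>" for n j
  proof -
    have "1 / 2 ^ k \<le> dist (\<alpha> n) (\<alpha> j)"
      using that(1-3) mem_net_iff[of n I q k] by (intro far_of_not_near) blast
    also have "\<dots> < 2 * \<epsilon>" using that(4,5) dist_triangle2[of "\<alpha> n" "\<alpha> j" x] by simp
    also have "\<dots> \<le> 1 / 2 ^ k" using assms by simp
    finally show False by simp
  qed
  have "n = j" if "n \<in> net I q k" "j \<in> net I q k" "dist (\<alpha> n) x < \<epsilon>" "dist (\<alpha> j) x < \<epsilon>" for n j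
    using sep[of n j] sep[of j n] that by (meson nat_neq_iff)
  then have "\<exists>j. {n \<in> net I q k. dist (\<alpha> n) x < \<epsilon>} \<subseteq> {j}" by blast
  then show ?thesis using finite_subset by blast
qed

theorem psi_star_net_sequence_name:
  assumes "psi_minus_jump \<alpha> p = Some A"
  shows "psi_star \<alpha> (net_sequence_name I p) = Some A"
proof -
  obtain q where lim: "component p \<longlonglongrightarrow> q" and A: "A = - (\<Union>i. basic_ball \<alpha> (q i))"
    using assms unfolding psi_minus_jump_def map_comp_def
    by (auto simp: psi_minus_def Compl_eq_Diff_UNIV baire_lim_eq_Some_iff split: option.splits)
  have stable: "\<exists>u. \<forall>s\<ge>u. \<forall>i\<le>k. component p s i = q i" for k
  proof -
    have "\<forall>\<^sub>F s in sequentially. \<forall>i\<in>{..k}. component p s i = q i"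
      using lim unfolding baire_tendsto_iff by (intro eventually_ball_finite) auto
    then show ?thesis by (auto simp: eventually_sequentially)
  qed
  have net_cong: "net I (component p s) k = net I q k"
    if "\<forall>i\<le>k. component p s i = q i" for s k
  proof -
    have "consistent I (component p s) k = consistent I q k"
      using that by (auto simp: consistent_def)
    then show ?thesis by (simp add: net_def)
  qed
  define x where "x = (\<lambda>w. dense_infty \<alpha> (net_sequence I p w))"
  have "component (net_sequence_name I p) w = (\<lambda>_. net_sequence I p w)" for w
    by (simp add: component_def net_sequence_name_def)
  then have "seq_rep (cauchy_rep dist_infty (dense_infty \<alpha>)) (net_sequence_name I p) = Some x"
    by (simp add: seq_rep_def cauchy_rep_infty_const dom_def x_def)
  moreover have "Pt -` cluster_points dist_infty x = A"
  proof (intro equalityI subsetI)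
    fix a assume a: "a \<in> A"
    have "\<exists>w\<ge>l. dist_infty (x w) (Pt a) < \<epsilon>" if e: "\<epsilon> > 0" for \<epsilon> l
    proof -
      obtain k0 where k0: "\<And>k. k0 \<le> k \<Longrightarrow> 1 / 2 ^ k < \<epsilon> / 4"
        using ex_inverse_power2_less[of "\<epsilon> / 4"] e by auto
      define k where "k = max k0 l"
      have k: "l \<le> k" "4 / 2 ^ k < \<epsilon>" using k0[of k] by (auto simp: k_def)
      obtain n where n: "n \<in> net I q k" "dist (\<alpha> n) a < 4 / 2 ^ k"
        using ex_close_in_net[of a q k] a A by blast
      define m where "m = prod_encode (n, k)"
      let ?stable = "\<lambda>s. m \<le> s \<and> (\<forall>s'\<ge>s. \<forall>i\<le>k. component p s' i = q i)"
      obtain u where "\<forall>s\<ge>u. \<forall>i\<le>k. component p s i = q i" using stable by blast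
      then have "?stable (max m u)" by simp
      (* At the first stable stage the candidate has just appeared or the approximation has
         just changed. *)
      define s where "s = (LEAST s. ?stable s)"
      have s: "?stable s" unfolding s_def using \<open>?stable (max m u)\<close> by (rule LeastI)
      have new: "\<exists>i\<le>k. component p (s - 1) i \<noteq> component p s i" if "s \<noteq> m"
      proof -
        have s': "m \<le> s - 1" "s - 1 < s" using that s by auto
        have "\<not> ?stable (s - 1)"
          using s'(2) not_less_Least[of "s - 1" ?stable] unfolding s_def by blast
        then obtain s' i where i: "s - 1 \<le> s'" "i \<le> k" "component p s' i \<noteq> q i"
          using s'(1) by blast
        then have "\<not> s \<le> s'" using s by blast
        then have "s' = s - 1" using i(1) by simp
        then show ?thesis using i s by auto
      qed
      define w where "w = prod_encode (m, s - m)"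
      have "n \<in> net I (component p s) k" using n(1) net_cong[of k s] s by simp
      moreover have "s - m = 0 \<or> (\<exists>i\<le>k. component p (s - 1) i \<noteq> component p s i)"
        using new by (cases "s = m") (simp, blast)
      moreover have "m + (s - m) = s" "prod_decode m = (n, k)" using s by (simp_all add: m_def)
      ultimately have "net_sequence I p w = Suc n"
        by (simp only: net_sequence_def Let_def w_def prod_encode_inverse fst_conv snd_conv) simp
      then have "x w = Pt (\<alpha> n)" by (simp add: x_def)
      moreover have "l \<le> w"
        using k(1) le_prod_encode_2[of k n] le_prod_encode_1[of m "s - m"] by (simp add: w_def m_def)
      ultimately show ?thesis using n(2) k(2) by auto
    qed
    then show "a \<in> Pt -` cluster_points dist_infty x"
      by (simp add: cluster_points_def infinite_nat_iff_unbounded_le)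
  next
    fix a assume cluster: "a \<in> Pt -` cluster_points dist_infty x"
    show "a \<in> A"
    proof (rule ccontr)
      assume "a \<notin> A"
      then obtain i where i: "a \<in> basic_ball \<alpha> (q i)" using A by blast
      obtain c r where qi: "q i = prod_encode (c, r)" by (metis prod.collapse prod_decode_inverse)
      then have "0 < (rat_enum r - dist (\<alpha> c) a) / 4" using i by (simp add: basic_ball_def)
      then obtain k0 where k0: "\<And>k. k0 \<le> k \<Longrightarrow> 1 / 2 ^ k < (rat_enum r - dist (\<alpha> c) a) / 4"
        using ex_inverse_power2_less by blast
      (* From K on, both \<epsilon> and the precision 1/2^k are below a quarter of the room that a has in the
         ball q i, and q i is among the balls tested for consistency. *)
      define K where "K = max k0 i"
      define \<epsilon> :: real where "\<epsilon> = 1 / 2 ^ Suc K"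
      obtain u where u: "\<And>s i. u \<le> s \<Longrightarrow> i \<le> K \<Longrightarrow> component p s i = q i"
        using stable by blast
      (* Close to a, the entries treated after stage u belong to the nets of the finitely many
         precisions below K, and they are entered at t = 0 only. *)
      let ?early = "prod_encode ` ({..u} \<times> {..u})"
      let ?late = "\<Union>k<K. (\<lambda>n. prod_encode (prod_encode (n, k), 0)) ` {n \<in> net I q k. dist (\<alpha> n) a < \<epsilon>}"
      have "w \<in> ?early \<union> ?late" if w: "dist_infty (x w) (Pt a) < \<epsilon>" for w
      proof -
        obtain n k t where w_eq: "w = prod_encode (prod_encode (n, k), t)"
          by (metis prod.collapse prod_decode_inverse)
        define s where "s = prod_encode (n, k) + t"
        have "\<epsilon> < 1" using power_gt1[of "2 :: real" K] by (simp add: \<epsilon>_def field_simps)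
        then have "net_sequence I p w \<noteq> 0" using w
          by (cases "net_sequence I p w") (simp_all add: x_def)
        then have time: "t = 0 \<or> (\<exists>i\<le>k. component p (s - 1) i \<noteq> component p s i)"
          and net: "n \<in> net I (component p s) k" and "net_sequence I p w = Suc n"
          by (auto simp: net_sequence_def w_eq s_def Let_def split: if_splits)
        then have dist: "dist (\<alpha> n) a < \<epsilon>" using w by (simp add: x_def)
        show ?thesis
        proof (cases "s \<le> u")
          case True
          then show ?thesis by (auto simp: w_eq s_def intro!: imageI)
        next
          case False
          have "k < K"
          proof (rule ccontr)
            assume "\<not> k < K"
            then have k: "k0 \<le> k" "i \<le> k" "i \<le> K" by (auto simp: K_def)
            have "dist (\<alpha> n) (\<alpha> c) \<le> dist (\<alpha> c) a + \<epsilon>"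
              using dist dist_triangle2[of "\<alpha> n" "\<alpha> c" a] by simp
            moreover have "1 / 2 ^ k < (rat_enum r - dist (\<alpha> c) a) / 4"
              "\<epsilon> < (rat_enum r - dist (\<alpha> c) a) / 4"
              using k0[of k] k0[of "Suc K"] k by (simp_all add: \<epsilon>_def K_def)
            ultimately have "dist (\<alpha> n) (\<alpha> c) + 3 * (1 / 2 ^ k) < rat_enum r" by argo
            then have "I n (q i) k" using complete by (simp add: qi)
            moreover have "component p s i = q i" using u[of s i] False k by simp
            moreover have "consistent I (component p s) k n"
              using net mem_net_iff by blast
            ultimately show False using k by (auto simp: consistent_def)
          qed
          moreover have "component p (s - 1) j = component p s j" if "j \<le> k" for j
            using u[of s j] u[of "s - 1" j] False \<open>k < K\<close> that by simp
          then have "t = 0" using time by blast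
          moreover have "net I (component p s) k = net I q k"
            using u False \<open>k < K\<close> by (intro net_cong) simp
          ultimately show ?thesis using net dist by (auto simp: w_eq)
        qed
      qed
      then have "{w. dist_infty (x w) (Pt a) < \<epsilon>} \<subseteq> ?early \<union> ?late" by blast
      moreover have "\<epsilon> \<le> 1 / 2 ^ Suc k" if "k < K" for k
        using that by (simp add: \<epsilon>_def field_simps)
      then have "finite (?early \<union> ?late)"
        by (intro finite_UnI finite_imageI finite_cartesian_product finite_UN_I finite_net_close)
          simp_all
      ultimately have "finite {w. dist_infty (x w) (Pt a) < \<epsilon>}" by (rule finite_subset)
      moreover have "\<epsilon> > 0" by (simp add: \<epsilon>_def)
      ultimately show False using cluster unfolding cluster_points_def by blast
    qed
  qed
  ultimately show ?thesis by (simp add: psi_star_def)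
qed

end

section \<open>Equivalence of the two representations\<close>

lemma computable_baire_total:
  assumes "computable_in fst [snd] (\<lambda>z. f (fst z) (snd z))"
  shows "computable_baire (\<lambda>p. Some (f p))"
proof -
  obtain M where "\<And>z. eval (fst z) M (map (\<lambda>v. v z) [snd]) = Some (f (fst z) (snd z))"
    using assms unfolding computable_in_def by blast
  from this[of "(p, n)" for p n] have "eval p M [n] = Some (f p n)" for p n by simp
  then show ?thesis unfolding computable_baire_def by auto
qed

lemma computably_reducible_total:
  assumes "computable_in fst [snd] (\<lambda>z. f (fst z) (snd z))"
    and "\<And>p x. \<delta> p = Some x \<Longrightarrow> \<delta>' (f p) = Some x"
  shows "computably_reducible \<delta> \<delta>'"
  unfolding computably_reducible_def
  by (intro exI[of _ "\<lambda>p. Some (f p)"] conjI ballI computable_baire_total assms(1))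
    (auto simp: assms(2))

lemma computable_map_of_reducible:
  assumes "computably_reducible \<delta> \<delta>'" and "\<And>x. x \<in> ran \<delta> \<Longrightarrow> f x = x"
  shows "computable_map \<delta> \<delta>' f"
proof -
  obtain F where F: "computable_baire F" "\<And>p. p \<in> dom \<delta> \<Longrightarrow> \<exists>q. F p = Some q \<and> \<delta>' q = \<delta> p"
    using assms(1) unfolding computably_reducible_def by blast
  have "\<exists>q. F p = Some q \<and> \<delta>' q = Some (f x)" if "\<delta> p = Some x" for p x
    using F(2)[of p] assms(2)[OF ranI[of \<delta> p x]] that by auto
  then show ?thesis using F(1) unfolding computable_map_def realizes_def by blast
qed

theorem proposition3p6:
  fixes \<alpha> :: "nat \<Rightarrow> 'a::metric_space"
  assumes "computable_metric_space \<alpha>"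
  shows "computable_isomorphism (psi_star \<alpha>) (psi_minus_jump \<alpha>) id \<and>
    computably_equivalent (psi_star \<alpha>) (psi_minus_jump \<alpha>)"
proof -
  obtain I where "formal_inclusion \<alpha> I" and I: "decidable3 I"
    by (rule ex_decidable_formal_inclusion[OF assms])
  then interpret formal_inclusion \<alpha> I by simp
  have star_le: "computably_reducible (psi_star \<alpha>) (psi_minus_jump \<alpha>)"
    by (rule computably_reducible_total[where f = "avoided_balls I"])
      (rule computable_avoided_balls[OF I], rule psi_minus_jump_avoided_balls)
  have minus_le: "computably_reducible (psi_minus_jump \<alpha>) (psi_star \<alpha>)"
    by (rule computably_reducible_total[where f = "net_sequence_name I"])
      (rule computable_net_sequence_name[OF I], rule psi_star_net_sequence_name)
  have ran: "ran (psi_minus_jump \<alpha>) = ran (psi_star \<alpha>)"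
    using ran_psi_star[OF dense] ran_psi_minus_jump[OF dense] by simp
  have "inv_into (ran (psi_star \<alpha>)) id A = A" if "A \<in> ran (psi_minus_jump \<alpha>)" for A
    using inv_into_f_f[of id "ran (psi_star \<alpha>)" A] that by (simp add: ran)
  then have "computable_isomorphism (psi_star \<alpha>) (psi_minus_jump \<alpha>) id"
    using star_le minus_le unfolding computable_isomorphism_def
    by (auto simp: ran intro: computable_map_of_reducible)
  then show ?thesis using star_le minus_le by (simp add: computably_equivalent_def)
qed

end
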